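(* Let $A_\Gamma$ be a right-angled Artin group with standard generators $g_1,\dots,g_n$, where $\Gamma$ is a simple graph, and assume that none of the $g_i$ lies in the center of $A_\Gamma$. Let $P$ be the set of all unordered pairs $\{i,j\}\subseteq\{1,\dots,n\}$ for which $g_ig_j\neq g_jg_i$, and let $X$ be the Cantor cube $$X=\prod_{i=1}^n\{0,1\}^\omega\times\prod_{\{i,j\}\in P}\{i,j,\emptyset\}^\omega .$$ Then $A_\Gamma$ embeds into the rearrangement group $XV$, and hence $A_\Gamma$ embeds into the Brin-Thompson group $kV$ for $k=n+|P|$.
   Context: A simple graph is a finite (undirected) graph with no loops and no multiple edges. For a simple graph $\Gamma$ with vertices $v_1,\dots,v_n$, the right-angled Artin group is $A_\Gamma=\langle g_1,\dots,g_n\mid g_ig_j=g_jg_i\text{ whenever } v_i,v_j\text{ are joined by an edge}\rangle$. In the alphabet $\{i,j,\emptyset\}$ the symbols $i$, $j$, $\emptyset$ are three distinct letters. For a finite alphabet $\Sigma$, $\Sigma^\omega$ is the space of infinite strings over $\Sigma$ with the product topology, and $\Sigma^*$ is the set of finite strings (including the empty one). A Cantor cube is a finite product $X=\Sigma_1^\omega\times\cdots\times\Sigma_m^\omega$ with each $\Sigma_i$ a finite alphabet with at least two symbols. For $(\alpha_1,\dots,\alpha_m)\in\Sigma_1^*\times\cdots\times\Sigma_m^*$, the subcube $X(\alpha_1,\dots,\alpha_m)$ is the set of all $(x_1,\dots,x_m)\in X$ such that $x_i$ begins with $\alpha_i$ for each $i$. The canonical homeomorphism between subcubes $X(\alpha_1,\dots,\alpha_m)$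 and $X(\beta_1,\dots,\beta_m)$ is the prefix replacement $(\alpha_1\cdot x_1,\dots,\alpha_m\cdot x_m)\mapsto(\beta_1\cdot x_1,\dots,\beta_m\cdot x_m)$, where $\cdot$ is concatenation. A rearrangement of $X$ is a homeomorphism $h\colon X\to X$ for which there are two partitions $D_1,\dots,D_r$ and $R_1,\dots,R_r$ of $X$ into the same finite number of subcubes such that $h$ maps each $D_i$ to $R_i$ by the canonical homeomorphism. The rearrangements of $X$ form a group $XV$ under composition. For $X=(\{0,1\}^\omega)^k$, the group $XV$ is the Brin-Thompson group $kV$. *)

theory Defs
  imports "HOL-Algebra.Algebra" "HOL-Analysis.Analysis" "HOL-Library.Omega_Words_Fun"
begin

section \<open>Simple graphs\<close>

definition simple_graph :: "'v set \<Rightarrow> 'v set set \<Rightarrow> bool" where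
  "simple_graph V E \<longleftrightarrow> finite V \<and> (\<forall>e\<in>E. \<exists>u\<in>V. \<exists>w\<in>V. u \<noteq> w \<and> e = {u, w})"


section \<open>Groups given by generators and relations\<close>

text \<open>A letter \<^term>\<open>(s, True)\<close> stands for the generator \<open>s\<close>, and \<^term>\<open>(s, False)\<close> for its
  formal inverse.\<close>

type_synonym 's gword = "('s \<times> bool) list"

definition gwords :: "'s set \<Rightarrow> 's gword set" where
  "gwords S = lists (S \<times> UNIV)"

inductive gword_eq :: "'s set \<Rightarrow> ('s gword \<times> 's gword) set \<Rightarrow> 's gword \<Rightarrow> 's gword \<Rightarrow> bool"
  for S R where
  refl: "u \<in> gwords S \<Longrightarrow> gword_eq S R u u"
| sym: "gword_eq S R u w \<Longrightarrow> gword_eq S R w u"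
| trans: "gword_eq S R u w \<Longrightarrow> gword_eq S R w x \<Longrightarrow> gword_eq S R u x"
| cancel: "u \<in> gwords S \<Longrightarrow> w \<in> gwords S \<Longrightarrow> s \<in> S \<Longrightarrow>
    gword_eq S R (u @ [(s, b), (s, \<not> b)] @ w) (u @ w)"
| relation: "u \<in> gwords S \<Longrightarrow> w \<in> gwords S \<Longrightarrow> (l, r) \<in> R \<Longrightarrow> l \<in> gwords S \<Longrightarrow> r \<in> gwords S \<Longrightarrow>
    gword_eq S R (u @ l @ w) (u @ r @ w)"

definition gword_rel :: "'s set \<Rightarrow> ('s gword \<times> 's gword) set \<Rightarrow> ('s gword \<times> 's gword) set" where
  "gword_rel S R = {(u, w). gword_eq S R u w}"

text \<open>\<open>presented_group S R\<close> is \<open>\<langle>S | l = r for (l, r) \<in> R\<rangle>\<close>.\<close>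

definition presented_group :: "'s set \<Rightarrow> ('s gword \<times> 's gword) set \<Rightarrow> 's gword set monoid" where
  "presented_group S R =
    \<lparr>carrier = gwords S // gword_rel S R,
     monoid.mult = (\<lambda>A B. \<Union>a\<in>A. \<Union>b\<in>B. gword_rel S R `` {a @ b}),
     one = gword_rel S R `` {[]}\<rparr>"

definition presented_gen :: "'s set \<Rightarrow> ('s gword \<times> 's gword) set \<Rightarrow> 's \<Rightarrow> 's gword set" where
  "presented_gen S R s = gword_rel S R `` {[(s, True)]}"

lemma gword_eq_in_gwords: "gword_eq S R u w \<Longrightarrow> u \<in> gwords S \<and> w \<in> gwords S"
  by (induction rule: gword_eq.induct) (auto simp: gwords_def)

lemma equiv_gword_rel: "equiv (gwords S) (gword_rel S R)"
proof (rule equivI)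
  show "gword_rel S R \<subseteq> gwords S \<times> gwords S"
    using gword_eq_in_gwords by (fastforce simp: gword_rel_def)
  show "refl_on (gwords S) (gword_rel S R)"
    by (auto simp: refl_on_def gword_rel_def intro: gword_eq.refl)
  show "sym (gword_rel S R)"
    unfolding sym_def gword_rel_def using gword_eq.sym by blast
  show "trans (gword_rel S R)"
    by (rule transI) (simp add: gword_rel_def, erule (1) gword_eq.trans)
qed

lemma gword_eq_context:
  assumes "gword_eq S R u w" "x \<in> gwords S" "y \<in> gwords S"
  shows "gword_eq S R (x @ u @ y) (x @ w @ y)"
  using assms
proof (induction rule: gword_eq.induct)
  case (refl u)
  then show ?case by (auto simp: gwords_def intro!: gword_eq.refl)
next
  case (sym u w)
  show ?case by (rule gword_eq.sym, rule sym.IH) fact+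
next
  case (trans u w z)
  show ?case
    by (rule gword_eq.trans[OF trans.IH(1) trans.IH(2)]) fact+
next
  case (cancel u w s b)
  then have "gword_eq S R ((x @ u) @ [(s, b), (s, \<not> b)] @ (w @ y)) ((x @ u) @ (w @ y))"
    by (intro gword_eq.cancel) (auto simp: gwords_def)
  then show ?case by simp
next
  case (relation u w l r)
  then have "gword_eq S R ((x @ u) @ l @ (w @ y)) ((x @ u) @ r @ (w @ y))"
    by (intro gword_eq.relation) (auto simp: gwords_def)
  then show ?case by simp
qed

lemma gword_eq_append:
  assumes "gword_eq S R u u'" "gword_eq S R w w'"
  shows "gword_eq S R (u @ w) (u' @ w')"
proof -
  have nil: "[] \<in> gwords S" by (simp add: gwords_def)
  have "gword_eq S R (u @ w) (u' @ w)"
    using gword_eq_context[OF assms(1) nil, of w] gword_eq_in_gwords[OF assms(2)] by simp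
  moreover have "gword_eq S R (u' @ w) (u' @ w')"
    using gword_eq_context[OF assms(2) _ nil, of u'] gword_eq_in_gwords[OF assms(1)] by simp
  ultimately show ?thesis by (rule gword_eq.trans)
qed

lemma presented_group_mult:
  assumes "u \<in> gwords S" "w \<in> gwords S"
  shows "gword_rel S R `` {u} \<otimes>\<^bsub>presented_group S R\<^esub> gword_rel S R `` {w} = gword_rel S R `` {u @ w}"
proof -
  have "gword_rel S R `` {a @ b} = gword_rel S R `` {u @ w}"
    if "a \<in> gword_rel S R `` {u}" "b \<in> gword_rel S R `` {w}" for a b
  proof -
    have "gword_eq S R (u @ w) (a @ b)"
      using that by (intro gword_eq_append) (simp_all add: gword_rel_def)
    then show ?thesis
      by (intro equiv_class_eq[OF equiv_gword_rel]) (simp add: gword_rel_def gword_eq.sym)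
  qed
  moreover have "u \<in> gword_rel S R `` {u}" "w \<in> gword_rel S R `` {w}"
    using assms by (auto simp: gword_rel_def intro: gword_eq.refl)
  ultimately have "(\<Union>a\<in>gword_rel S R `` {u}. \<Union>b\<in>gword_rel S R `` {w}. gword_rel S R `` {a @ b}) =
      gword_rel S R `` {u @ w}"
    by blast
  then show ?thesis by (simp add: presented_group_def)
qed

definition gword_inv :: "'s gword \<Rightarrow> 's gword" where
  "gword_inv u = rev (map (\<lambda>(s, b). (s, \<not> b)) u)"

lemma gword_inv_in: "u \<in> gwords S \<Longrightarrow> gword_inv u \<in> gwords S"
  by (auto simp: gword_inv_def gwords_def)

lemma gword_inv_left:
  "u \<in> gwords S \<Longrightarrow> gword_eq S R (gword_inv u @ u) []"
proof (induction u)
  case Nil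
  then show ?case by (auto simp: gword_inv_def intro: gword_eq.refl)
next
  case (Cons a u)
  obtain s b where a: "a = (s, b)" by (cases a)
  have u: "u \<in> gwords S" and s: "s \<in> S" using Cons.prems a by (auto simp: gwords_def)
  have "gword_eq S R (gword_inv u @ [(s, \<not> b), (s, \<not> \<not> b)] @ u) (gword_inv u @ u)"
    by (rule gword_eq.cancel) (use u s gword_inv_in in auto)
  then have "gword_eq S R (gword_inv (a # u) @ a # u) (gword_inv u @ u)"
    by (simp add: a gword_inv_def)
  then show ?case using Cons.IH[OF u] by (rule gword_eq.trans)
qed

lemma group_presented_group: "group (presented_group S R)"
proof (rule groupI)
  let ?G = "presented_group S R"
  let ?c = "\<lambda>u. gword_rel S R `` {u}"
  have car: "carrier ?G = gwords S // gword_rel S R" by (simp add: presented_group_def)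
  have one: "\<one>\<^bsub>?G\<^esub> = ?c []" by (simp add: presented_group_def)
  have nil: "[] \<in> gwords S" by (simp add: gwords_def)
  have app: "u @ w \<in> gwords S" if "u \<in> gwords S" "w \<in> gwords S" for u w :: "'a gword"
    using that by (auto simp: gwords_def)
  have rep: "\<exists>u\<in>gwords S. x = ?c u" if "x \<in> carrier ?G" for x
    using that unfolding car by (auto elim: quotientE)
  show "\<one>\<^bsub>?G\<^esub> \<in> carrier ?G" using nil by (simp add: car one quotientI)
  fix x assume "x \<in> carrier ?G"
  then obtain u where u: "u \<in> gwords S" "x = ?c u" using rep by blast
  show "\<one>\<^bsub>?G\<^esub> \<otimes>\<^bsub>?G\<^esub> x = x"
    by (simp add: one u presented_group_mult nil)
  have "?c (gword_inv u @ u) = ?c []"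
    by (rule equiv_class_eq[OF equiv_gword_rel]) (simp add: gword_rel_def gword_inv_left u)
  then have "?c (gword_inv u) \<otimes>\<^bsub>?G\<^esub> x = \<one>\<^bsub>?G\<^esub>"
    by (simp add: one u presented_group_mult gword_inv_in)
  then show "\<exists>y\<in>carrier ?G. y \<otimes>\<^bsub>?G\<^esub> x = \<one>\<^bsub>?G\<^esub>"
    using u gword_inv_in by (fastforce simp: car intro: quotientI)
  fix y assume "y \<in> carrier ?G"
  then obtain w where w: "w \<in> gwords S" "y = ?c w" using rep by blast
  show "x \<otimes>\<^bsub>?G\<^esub> y \<in> carrier ?G"
    by (simp add: car u w presented_group_mult app quotientI)
  fix z assume "z \<in> carrier ?G"
  then obtain t where t: "t \<in> gwords S" "z = ?c t" using rep by blast
  show "x \<otimes>\<^bsub>?G\<^esub> y \<otimes>\<^bsub>?G\<^esub> z = x \<otimes>\<^bsub>?G\<^esub> (y \<otimes>\<^bsub>?G\<^esub> z)"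
    by (simp add: u w t presented_group_mult app)
qed

definition group_center :: "('a, 'b) monoid_scheme \<Rightarrow> 'a set" where
  "group_center G = {z \<in> carrier G. \<forall>x\<in>carrier G. z \<otimes>\<^bsub>G\<^esub> x = x \<otimes>\<^bsub>G\<^esub> z}"


section \<open>Right-angled Artin groups\<close>

text \<open>The graph has vertices \<open>v 1, \<dots>, v n\<close> and edge set \<open>E\<close>; the generator \<open>g\<^sub>i\<close> is the symbol \<open>i\<close>.\<close>

definition raag_relations :: "nat \<Rightarrow> (nat \<Rightarrow> 'v) \<Rightarrow> 'v set set \<Rightarrow> (nat gword \<times> nat gword) set" where
  "raag_relations n v E =
    {([(i, True), (j, True)], [(j, True), (i, True)]) | i j.
       i \<in> {1..n} \<and> j \<in> {1..n} \<and> {v i, v j} \<in> E}"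

definition raag :: "nat \<Rightarrow> (nat \<Rightarrow> 'v) \<Rightarrow> 'v set set \<Rightarrow> nat gword set monoid" where
  "raag n v E = presented_group {1..n} (raag_relations n v E)"

definition raag_gen :: "nat \<Rightarrow> (nat \<Rightarrow> 'v) \<Rightarrow> 'v set set \<Rightarrow> nat \<Rightarrow> nat gword set" where
  "raag_gen n v E i = presented_gen {1..n} (raag_relations n v E) i"


section \<open>Cantor cubes and their rearrangement groups\<close>

text \<open>The factors of a Cantor cube are indexed by a finite set \<open>I\<close>, and \<open>\<Sigma> i\<close> is the alphabet of the
  factor \<open>i\<close>. Points are functions that are \<^const>\<open>undefined\<close> outside \<open>I\<close>.\<close>

definition cantor_cube :: "'i set \<Rightarrow> ('i \<Rightarrow> 'a set) \<Rightarrow> ('i \<Rightarrow> 'a word) topology" where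
  "cantor_cube I \<Sigma> =
    product_topology (\<lambda>i. product_topology (\<lambda>_::nat. discrete_topology (\<Sigma> i)) UNIV) I"

abbreviation cantor_points :: "'i set \<Rightarrow> ('i \<Rightarrow> 'a set) \<Rightarrow> ('i \<Rightarrow> 'a word) set" where
  "cantor_points I \<Sigma> \<equiv> topspace (cantor_cube I \<Sigma>)"

definition subcube :: "'i set \<Rightarrow> ('i \<Rightarrow> 'a set) \<Rightarrow> ('i \<Rightarrow> 'a list) \<Rightarrow> ('i \<Rightarrow> 'a word) set" where
  "subcube I \<Sigma> \<alpha> =
    {x \<in> cantor_points I \<Sigma>. \<forall>i\<in>I. Omega_Words_Fun.prefix (length (\<alpha> i)) (x i) = \<alpha> i}"

definition prepend :: "'i set \<Rightarrow> ('i \<Rightarrow> 'a list) \<Rightarrow> ('i \<Rightarrow> 'a word) \<Rightarrow> 'i \<Rightarrow> 'a word" where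
  "prepend I \<alpha> x = (\<lambda>i\<in>I. \<alpha> i \<frown> x i)"

definition subcube_partition ::
  "'i set \<Rightarrow> ('i \<Rightarrow> 'a set) \<Rightarrow> nat \<Rightarrow> (nat \<Rightarrow> 'i \<Rightarrow> 'a list) \<Rightarrow> bool" where
  "subcube_partition I \<Sigma> r \<alpha> \<longleftrightarrow>
    (\<forall>k<r. \<forall>i\<in>I. \<alpha> k i \<in> lists (\<Sigma> i)) \<and>
    disjoint_family_on (\<lambda>k. subcube I \<Sigma> (\<alpha> k)) {..<r} \<and>
    (\<Union>k<r. subcube I \<Sigma> (\<alpha> k)) = cantor_points I \<Sigma>"

definition rearrangements :: "'i set \<Rightarrow> ('i \<Rightarrow> 'a set) \<Rightarrow> (('i \<Rightarrow> 'a word) \<Rightarrow> ('i \<Rightarrow> 'a word)) set" where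
  "rearrangements I \<Sigma> =
    {h \<in> extensional (cantor_points I \<Sigma>).
      homeomorphic_map (cantor_cube I \<Sigma>) (cantor_cube I \<Sigma>) h \<and>
      (\<exists>r \<alpha> \<beta>. subcube_partition I \<Sigma> r \<alpha> \<and> subcube_partition I \<Sigma> r \<beta> \<and>
        (\<forall>k<r. \<forall>x\<in>cantor_points I \<Sigma>. h (prepend I (\<alpha> k) x) = prepend I (\<beta> k) x))}"

definition rearrangement_group ::
  "'i set \<Rightarrow> ('i \<Rightarrow> 'a set) \<Rightarrow> (('i \<Rightarrow> 'a word) \<Rightarrow> ('i \<Rightarrow> 'a word)) monoid" where
  "rearrangement_group I \<Sigma> = (BijGroup (cantor_points I \<Sigma>))\<lparr>carrier := rearrangements I \<Sigma>\<rparr>"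

definition brin_thompson :: "nat \<Rightarrow> ((nat \<Rightarrow> nat word) \<Rightarrow> (nat \<Rightarrow> nat word)) monoid" where
  "brin_thompson k = rearrangement_group {1..k} (\<lambda>_. {0, 1})"

lemma cantor_points_eq: "cantor_points I \<Sigma> = (\<Pi>\<^sub>E i\<in>I. {x. range x \<subseteq> \<Sigma> i})"
proof -
  have "(\<Pi>\<^sub>E n\<in>(UNIV::nat set). \<Sigma> i) = {x. range x \<subseteq> \<Sigma> i}" for i
    by (auto simp: PiE_UNIV_domain)
  moreover have "cantor_points I \<Sigma> = (\<Pi>\<^sub>E i\<in>I. \<Pi>\<^sub>E n\<in>UNIV. \<Sigma> i)"
    by (simp add: cantor_cube_def comp_def)
  ultimately show ?thesis by (simp only:)
qed

lemma subcube_eq_prepend: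
  assumes "\<forall>i\<in>I. \<alpha> i \<in> lists (\<Sigma> i)"
  shows "subcube I \<Sigma> \<alpha> = prepend I \<alpha> ` cantor_points I \<Sigma>"
proof (intro equalityI subsetI)
  fix x assume x: "x \<in> subcube I \<Sigma> \<alpha>"
  define y where "y = (\<lambda>i\<in>I. suffix (length (\<alpha> i)) (x i))"
  have xi: "x i = \<alpha> i \<frown> y i" if "i \<in> I" for i
    using x that prefix_suffix[of "x i" "length (\<alpha> i)"] by (simp add: subcube_def y_def)
  have "y \<in> cantor_points I \<Sigma>"
    using x by (fastforce simp: cantor_points_eq subcube_def y_def PiE_def)
  moreover have "x = prepend I \<alpha> y"
    using x xi by (auto simp: prepend_def subcube_def cantor_points_eq PiE_def extensional_def)
  ultimately show "x \<in> prepend I \<alpha> ` cantor_points I \<Sigma>" by blast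
next
  fix x assume "x \<in> prepend I \<alpha> ` cantor_points I \<Sigma>"
  then obtain y where y: "y \<in> cantor_points I \<Sigma>" "x = prepend I \<alpha> y" by blast
  have "range (\<alpha> i \<frown> y i) \<subseteq> \<Sigma> i" if "i \<in> I" for i
    using y assms that by (fastforce simp: cantor_points_eq conc_def PiE_def Pi_def in_lists_conv_set)
  then show "x \<in> subcube I \<Sigma> \<alpha>"
    using y by (auto simp: subcube_def prepend_def cantor_points_eq)
qed

lemma prepend_in_subcube:
  assumes "\<forall>i\<in>I. \<alpha> i \<in> lists (\<Sigma> i)" "x \<in> cantor_points I \<Sigma>"
  shows "prepend I \<alpha> x \<in> subcube I \<Sigma> \<alpha>" "prepend I \<alpha> x \<in> cantor_points I \<Sigma>"
proof -
  show *: "prepend I \<alpha> x \<in> subcube I \<Sigma> \<alpha>"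
    using assms by (simp add: subcube_eq_prepend)
  then show "prepend I \<alpha> x \<in> cantor_points I \<Sigma>"
    by (simp add: subcube_def)
qed

lemma prepend_append:
  assumes "\<forall>i\<in>I. \<gamma> i = \<alpha> i @ \<delta> i"
  shows "prepend I \<gamma> x = prepend I \<alpha> (prepend I \<delta> x)"
  using assms by (auto simp: prepend_def)

lemma subcube_Int:
  assumes \<alpha>: "\<forall>i\<in>I. \<alpha> i \<in> lists (\<Sigma> i)" and \<beta>: "\<forall>i\<in>I. \<beta> i \<in> lists (\<Sigma> i)"
    and ne: "subcube I \<Sigma> \<alpha> \<inter> subcube I \<Sigma> \<beta> \<noteq> {}"
  obtains \<gamma> \<delta> \<epsilon> where
    "\<forall>i\<in>I. \<gamma> i \<in> lists (\<Sigma> i)" "\<forall>i\<in>I. \<delta> i \<in> lists (\<Sigma> i)" "\<forall>i\<in>I. \<epsilon> i \<in> lists (\<Sigma> i)"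
    "\<forall>i\<in>I. \<gamma> i = \<alpha> i @ \<delta> i" "\<forall>i\<in>I. \<gamma> i = \<beta> i @ \<epsilon> i"
    "subcube I \<Sigma> \<gamma> = subcube I \<Sigma> \<alpha> \<inter> subcube I \<Sigma> \<beta>"
proof -
  let ?n = "\<lambda>i. max (length (\<alpha> i)) (length (\<beta> i))"
  obtain x where x: "x \<in> subcube I \<Sigma> \<alpha>" "x \<in> subcube I \<Sigma> \<beta>" using ne by blast
  define \<gamma> where "\<gamma> i = Omega_Words_Fun.prefix (?n i) (x i)" for i
  define \<delta> where "\<delta> i = drop (length (\<alpha> i)) (\<gamma> i)" for i
  define \<epsilon> where "\<epsilon> i = drop (length (\<beta> i)) (\<gamma> i)" for i
  have take_pre: "take m (Omega_Words_Fun.prefix n w) = Omega_Words_Fun.prefix m w"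
    if "m \<le> n" for m n and w :: "'b word"
    using that by (simp add: subsequence_def take_map)
  have a: "take (length (\<alpha> i)) (\<gamma> i) = \<alpha> i" "take (length (\<beta> i)) (\<gamma> i) = \<beta> i" if "i \<in> I" for i
    using x that unfolding \<gamma>_def by (simp_all add: take_pre subcube_def)
  have len: "length (\<gamma> i) = ?n i" for i by (simp add: \<gamma>_def)
  have g1: "\<forall>i\<in>I. \<gamma> i = \<alpha> i @ \<delta> i" using a(1) unfolding \<delta>_def by (metis append_take_drop_id)
  have g2: "\<forall>i\<in>I. \<gamma> i = \<beta> i @ \<epsilon> i" using a(2) unfolding \<epsilon>_def by (metis append_take_drop_id)
  have gin: "\<forall>i\<in>I. \<gamma> i \<in> lists (\<Sigma> i)"
    using x(1) by (fastforce simp: \<gamma>_def subsequence_def subcube_def cantor_points_eq PiE_def Pi_def)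
  have eq: "Omega_Words_Fun.prefix (length (\<gamma> i)) (y i) = \<gamma> i \<longleftrightarrow>
      Omega_Words_Fun.prefix (length (\<alpha> i)) (y i) = \<alpha> i \<and>
      Omega_Words_Fun.prefix (length (\<beta> i)) (y i) = \<beta> i" if i: "i \<in> I" for i y
  proof
    assume h: "Omega_Words_Fun.prefix (length (\<gamma> i)) (y i) = \<gamma> i"
    show "Omega_Words_Fun.prefix (length (\<alpha> i)) (y i) = \<alpha> i \<and>
      Omega_Words_Fun.prefix (length (\<beta> i)) (y i) = \<beta> i"
      using a[OF i] h take_pre[of "length (\<alpha> i)" "length (\<gamma> i)" "y i"]
        take_pre[of "length (\<beta> i)" "length (\<gamma> i)" "y i"] len[of i] by simp
  next
    assume h: "Omega_Words_Fun.prefix (length (\<alpha> i)) (y i) = \<alpha> i \<and>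
      Omega_Words_Fun.prefix (length (\<beta> i)) (y i) = \<beta> i"
    have "\<gamma> i = \<alpha> i \<or> \<gamma> i = \<beta> i"
      using a[OF i] len[of i] by (metis max_def order_refl take_all_iff)
    then show "Omega_Words_Fun.prefix (length (\<gamma> i)) (y i) = \<gamma> i" using h by auto
  qed
  show ?thesis
  proof (rule that[OF gin _ _ g1 g2])
    show "\<forall>i\<in>I. \<delta> i \<in> lists (\<Sigma> i)" "\<forall>i\<in>I. \<epsilon> i \<in> lists (\<Sigma> i)"
      using gin unfolding \<delta>_def \<epsilon>_def by (meson in_listsD in_listsI in_set_dropD)+
    show "subcube I \<Sigma> \<gamma> = subcube I \<Sigma> \<alpha> \<inter> subcube I \<Sigma> \<beta>"
      using eq by (auto simp: subcube_def)
  qed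
qed

lemma rearrangements_bij:
  assumes "h \<in> rearrangements I \<Sigma>"
  shows "h \<in> Bij (cantor_points I \<Sigma>)"
  using assms homeomorphic_imp_injective_map homeomorphic_imp_surjective_map
  by (fastforce simp: rearrangements_def Bij_def bij_betw_def)

lemma subcube_partition_reindex:
  assumes "finite K" "\<forall>k\<in>K. \<forall>i\<in>I. A k i \<in> lists (\<Sigma> i)"
    "disjoint_family_on (\<lambda>k. subcube I \<Sigma> (A k)) K"
    "(\<Union>k\<in>K. subcube I \<Sigma> (A k)) = cantor_points I \<Sigma>"
    and e: "bij_betw e {..<r} K"
  shows "subcube_partition I \<Sigma> r (A \<circ> e)"
proof -
  have img: "e ` {..<r} = K" and inj: "inj_on e {..<r}" using e by (auto simp: bij_betw_def)
  have "(\<Union>k<r. subcube I \<Sigma> ((A \<circ> e) k)) = (\<Union>k\<in>e ` {..<r}. subcube I \<Sigma> (A k))" by auto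
  moreover have "disjoint_family_on (\<lambda>k. subcube I \<Sigma> ((A \<circ> e) k)) {..<r}"
    unfolding disjoint_family_on_def
  proof (intro ballI impI)
    fix m n assume mn: "m \<in> {..<r}" "n \<in> {..<r}" "m \<noteq> n"
    then have "e m \<noteq> e n" "e m \<in> K" "e n \<in> K" using inj img by (auto dest: inj_onD)
    then show "subcube I \<Sigma> ((A \<circ> e) m) \<inter> subcube I \<Sigma> ((A \<circ> e) n) = {}"
      using assms(3) by (simp add: disjoint_family_on_def)
  qed
  moreover have "\<forall>k<r. \<forall>i\<in>I. (A \<circ> e) k i \<in> lists (\<Sigma> i)"
    using assms(2) img by fastforce
  ultimately show ?thesis using assms(4) img unfolding subcube_partition_def by metis
qed

lemma rearrangements_compose:
  assumes g: "g \<in> rearrangements I \<Sigma>" and f: "f \<in> rearrangements I \<Sigma>"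
  shows "compose (cantor_points I \<Sigma>) g f \<in> rearrangements I \<Sigma>"
proof -
  let ?X = "cantor_points I \<Sigma>"
  let ?h = "compose ?X g f"
  obtain r \<alpha> \<beta> where pa: "subcube_partition I \<Sigma> r \<alpha>" and pb: "subcube_partition I \<Sigma> r \<beta>"
    and fp: "\<And>k x. k < r \<Longrightarrow> x \<in> ?X \<Longrightarrow> f (prepend I (\<alpha> k) x) = prepend I (\<beta> k) x"
    using f unfolding rearrangements_def by blast
  obtain s \<alpha>' \<beta>' where pa': "subcube_partition I \<Sigma> s \<alpha>'" and pb': "subcube_partition I \<Sigma> s \<beta>'"
    and gp: "\<And>l x. l < s \<Longrightarrow> x \<in> ?X \<Longrightarrow> g (prepend I (\<alpha>' l) x) = prepend I (\<beta>' l) x"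
    using g unfolding rearrangements_def by blast
  have bf: "bij_betw f ?X ?X" and bg: "bij_betw g ?X ?X"
    using rearrangements_bij[OF f] rearrangements_bij[OF g] by (auto simp: Bij_def)
  define K where "K = {(k, l). k < r \<and> l < s \<and> subcube I \<Sigma> (\<beta> k) \<inter> subcube I \<Sigma> (\<alpha>' l) \<noteq> {}}"
  have finK: "finite K"
    by (rule finite_subset[of _ "{..<r} \<times> {..<s}"]) (auto simp: K_def)
  have la: "\<forall>i\<in>I. \<alpha> k i \<in> lists (\<Sigma> i)" "\<forall>i\<in>I. \<beta> k i \<in> lists (\<Sigma> i)" if "k < r" for k
    using pa pb that by (auto simp: subcube_partition_def)
  have la': "\<forall>i\<in>I. \<alpha>' k i \<in> lists (\<Sigma> i)" "\<forall>i\<in>I. \<beta>' k i \<in> lists (\<Sigma> i)" if "k < s" for k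
    using pa' pb' that by (auto simp: subcube_partition_def)
  let ?Q = "\<lambda>p (\<gamma>, \<delta>, \<epsilon>). (\<forall>i\<in>I. \<gamma> i \<in> lists (\<Sigma> i)) \<and> (\<forall>i\<in>I. \<delta> i \<in> lists (\<Sigma> i)) \<and>
      (\<forall>i\<in>I. \<epsilon> i \<in> lists (\<Sigma> i)) \<and>
      (\<forall>i\<in>I. \<gamma> i = \<beta> (fst p) i @ \<delta> i) \<and> (\<forall>i\<in>I. \<gamma> i = \<alpha>' (snd p) i @ \<epsilon> i) \<and>
      subcube I \<Sigma> \<gamma> = subcube I \<Sigma> (\<beta> (fst p)) \<inter> subcube I \<Sigma> (\<alpha>' (snd p))"
  have "\<exists>t. ?Q p t" if "p \<in> K" for p
  proof -
    have p: "fst p < r" "snd p < s" "subcube I \<Sigma> (\<beta> (fst p)) \<inter> subcube I \<Sigma> (\<alpha>' (snd p)) \<noteq> {}"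
      using that by (auto simp: K_def)
    obtain \<gamma> \<delta> \<epsilon> where
      "\<forall>i\<in>I. \<gamma> i \<in> lists (\<Sigma> i)" "\<forall>i\<in>I. \<delta> i \<in> lists (\<Sigma> i)" "\<forall>i\<in>I. \<epsilon> i \<in> lists (\<Sigma> i)"
      "\<forall>i\<in>I. \<gamma> i = \<beta> (fst p) i @ \<delta> i" "\<forall>i\<in>I. \<gamma> i = \<alpha>' (snd p) i @ \<epsilon> i"
      "subcube I \<Sigma> \<gamma> = subcube I \<Sigma> (\<beta> (fst p)) \<inter> subcube I \<Sigma> (\<alpha>' (snd p))"
      by (rule subcube_Int[OF la(2)[OF p(1)] la'(1)[OF p(2)] p(3)])
    then have "?Q p (\<gamma>, \<delta>, \<epsilon>)" by simp
    then show ?thesis by (rule exI)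
  qed
  then have "\<forall>p\<in>K. \<exists>t. ?Q p t" by blast
  then obtain T where T: "\<forall>p\<in>K. ?Q p (T p)" by (rule bchoice[THEN exE])
  define \<gamma> where "\<gamma> p = fst (T p)" for p
  define \<delta> where "\<delta> p = fst (snd (T p))" for p
  define \<epsilon> where "\<epsilon> p = snd (snd (T p))" for p
  have Q: "?Q p (\<gamma> p, \<delta> p, \<epsilon> p)" if "p \<in> K" for p
    using bspec[OF T that] unfolding \<gamma>_def \<delta>_def \<epsilon>_def case_prod_beta fst_conv snd_conv .
  have lg: "\<forall>i\<in>I. \<gamma> p i \<in> lists (\<Sigma> i)" and ld: "\<forall>i\<in>I. \<delta> p i \<in> lists (\<Sigma> i)"
    and le: "\<forall>i\<in>I. \<epsilon> p i \<in> lists (\<Sigma> i)" and g1: "\<forall>i\<in>I. \<gamma> p i = \<beta> (fst p) i @ \<delta> p i"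
    and g2: "\<forall>i\<in>I. \<gamma> p i = \<alpha>' (snd p) i @ \<epsilon> p i"
    and gI: "subcube I \<Sigma> (\<gamma> p) = subcube I \<Sigma> (\<beta> (fst p)) \<inter> subcube I \<Sigma> (\<alpha>' (snd p))"
    if "p \<in> K" for p
    using Q[OF that] unfolding case_prod_conv by blast+
  define A where "A p i = \<alpha> (fst p) i @ \<delta> p i" for p i
  define B where "B p i = \<beta>' (snd p) i @ \<epsilon> p i" for p i
  have KD: "fst p < r" "snd p < s" if "p \<in> K" for p
    using that by (auto simp: K_def)
  have lA: "\<forall>i\<in>I. A p i \<in> lists (\<Sigma> i)" if "p \<in> K" for p
    unfolding A_def append_in_lists_conv using ld[OF that] la(1)[OF KD(1)[OF that]] by blast
  have lB: "\<forall>i\<in>I. B p i \<in> lists (\<Sigma> i)" if "p \<in> K" for p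
    unfolding B_def append_in_lists_conv using le[OF that] la'(2)[OF KD(2)[OF that]] by blast
  have fA: "f (prepend I (A p) x) = prepend I (\<gamma> p) x" if "p \<in> K" "x \<in> ?X" for p x
  proof -
    have "fst p < r" using that by (auto simp: K_def)
    then show ?thesis
      using fp[of "fst p" "prepend I (\<delta> p) x"] prepend_in_subcube(2)[OF ld[OF that(1)] that(2)]
        prepend_append[OF g1[OF that(1)], of x] prepend_append[of I "A p" "\<alpha> (fst p)" "\<delta> p" x]
      by (simp add: A_def)
  qed
  have gB: "g (prepend I (\<gamma> p) x) = prepend I (B p) x" if "p \<in> K" "x \<in> ?X" for p x
  proof -
    have "snd p < s" using that by (auto simp: K_def)
    then show ?thesis
      using gp[of "snd p" "prepend I (\<epsilon> p) x"] prepend_in_subcube(2)[OF le[OF that(1)] that(2)]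
        prepend_append[OF g2[OF that(1)], of x] prepend_append[of I "B p" "\<beta>' (snd p)" "\<epsilon> p" x]
      by (simp add: B_def)
  qed
  have disj: "p = q" if "p \<in> K" "q \<in> K" "z \<in> subcube I \<Sigma> (\<gamma> p)" "z \<in> subcube I \<Sigma> (\<gamma> q)" for p q z
  proof -
    have "fst p < r" "fst q < r" "snd p < s" "snd q < s" using that by (auto simp: K_def)
    moreover have "z \<in> subcube I \<Sigma> (\<beta> (fst p)) \<inter> subcube I \<Sigma> (\<beta> (fst q))"
      "z \<in> subcube I \<Sigma> (\<alpha>' (snd p)) \<inter> subcube I \<Sigma> (\<alpha>' (snd q))"
      using that gI by auto
    moreover have "disjoint_family_on (\<lambda>k. subcube I \<Sigma> (\<beta> k)) {..<r}"
      "disjoint_family_on (\<lambda>k. subcube I \<Sigma> (\<alpha>' k)) {..<s}"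
      using pb pa' by (auto simp: subcube_partition_def)
    ultimately have "fst p = fst q" "snd p = snd q"
      unfolding disjoint_family_on_def by blast+
    then show ?thesis by (rule prod_eqI)
  qed
  have cover: "\<exists>p\<in>K. \<exists>x\<in>?X. z = prepend I (\<gamma> p) x" if z: "z \<in> ?X" for z
  proof -
    obtain k where k: "k < r" "z \<in> subcube I \<Sigma> (\<beta> k)"
      using pb z unfolding subcube_partition_def by blast
    obtain l where l: "l < s" "z \<in> subcube I \<Sigma> (\<alpha>' l)"
      using pa' z unfolding subcube_partition_def by blast
    have K: "(k, l) \<in> K" using k l by (auto simp: K_def)
    have "z \<in> subcube I \<Sigma> (\<gamma> (k, l))" using gI[OF K] k l by simp
    then show ?thesis using K subcube_eq_prepend[OF lg[OF K]] by blast
  qed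
  have pre: "\<exists>x\<in>?X. y = prepend I \<zeta> x" if "y \<in> subcube I \<Sigma> \<zeta>" "\<forall>i\<in>I. \<zeta> i \<in> lists (\<Sigma> i)" for y \<zeta>
    using that subcube_eq_prepend[OF that(2)] by blast
  have dA: "disjoint_family_on (\<lambda>p. subcube I \<Sigma> (A p)) K"
  proof -
    have "p = q" if "p \<in> K" "q \<in> K" "y \<in> subcube I \<Sigma> (A p)" "y \<in> subcube I \<Sigma> (A q)" for p q y
    proof -
      have "f y \<in> subcube I \<Sigma> (\<gamma> p)"
        using pre[OF that(3) lA[OF that(1)]] fA[OF that(1)] prepend_in_subcube(1)[OF lg[OF that(1)]]
        by metis
      moreover have "f y \<in> subcube I \<Sigma> (\<gamma> q)"
        using pre[OF that(4) lA[OF that(2)]] fA[OF that(2)] prepend_in_subcube(1)[OF lg[OF that(2)]]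
        by metis
      ultimately show ?thesis using disj that by blast
    qed
    then show ?thesis unfolding disjoint_family_on_def by blast
  qed
  have dB: "disjoint_family_on (\<lambda>p. subcube I \<Sigma> (B p)) K"
  proof -
    have "p = q" if "p \<in> K" "q \<in> K" "y \<in> subcube I \<Sigma> (B p)" "y \<in> subcube I \<Sigma> (B q)" for p q y
    proof -
      have "\<exists>x\<in>?X. y = prepend I (B p) x" "\<exists>x'\<in>?X. y = prepend I (B q) x'"
        using pre[OF that(3) lB[OF that(1)]] pre[OF that(4) lB[OF that(2)]] by blast+
      then obtain x x' where x: "x \<in> ?X" "y = prepend I (B p) x" "x' \<in> ?X" "y = prepend I (B q) x'"
        by blast
      have "g (prepend I (\<gamma> p) x) = g (prepend I (\<gamma> q) x')"
        using gB that x by metis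
      then have "prepend I (\<gamma> p) x = prepend I (\<gamma> q) x'"
        using bg prepend_in_subcube(2)[OF lg[OF that(1)] x(1)] prepend_in_subcube(2)[OF lg[OF that(2)] x(3)]
        by (meson bij_betw_imp_inj_on inj_onD)
      then show ?thesis
        using disj[OF that(1,2)] prepend_in_subcube(1)[OF lg] that x by metis
    qed
    then show ?thesis unfolding disjoint_family_on_def by blast
  qed
  have cA: "(\<Union>p\<in>K. subcube I \<Sigma> (A p)) = ?X"
  proof
    show "(\<Union>p\<in>K. subcube I \<Sigma> (A p)) \<subseteq> ?X" by (auto simp: subcube_def)
    show "?X \<subseteq> (\<Union>p\<in>K. subcube I \<Sigma> (A p))"
    proof
      fix y assume y: "y \<in> ?X"
      then have "f y \<in> ?X" using bf by (auto simp: bij_betw_def)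
      then obtain p x where p: "p \<in> K" "x \<in> ?X" "f y = prepend I (\<gamma> p) x" using cover by blast
      then have "f y = f (prepend I (A p) x)" using fA by simp
      then have "y = prepend I (A p) x"
        using bf y prepend_in_subcube(2)[OF lA[OF p(1)] p(2)]
        by (meson bij_betw_imp_inj_on inj_onD)
      then show "y \<in> (\<Union>p\<in>K. subcube I \<Sigma> (A p))"
        using prepend_in_subcube(1)[OF lA[OF p(1)] p(2)] p(1) by blast
    qed
  qed
  have cB: "(\<Union>p\<in>K. subcube I \<Sigma> (B p)) = ?X"
  proof
    show "(\<Union>p\<in>K. subcube I \<Sigma> (B p)) \<subseteq> ?X" by (auto simp: subcube_def)
    show "?X \<subseteq> (\<Union>p\<in>K. subcube I \<Sigma> (B p))"
    proof
      fix y assume y: "y \<in> ?X"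
      then obtain z where z: "z \<in> ?X" "y = g z" using bg by (auto simp: bij_betw_def)
      then obtain p x where p: "p \<in> K" "x \<in> ?X" "z = prepend I (\<gamma> p) x" using cover by blast
      then have "y = prepend I (B p) x" using gB z by simp
      then show "y \<in> (\<Union>p\<in>K. subcube I \<Sigma> (B p))"
        using prepend_in_subcube(1)[OF lB[OF p(1)] p(2)] p(1) by blast
    qed
  qed
  obtain e where e: "bij_betw e {..<card K} K"
    using ex_bij_betw_nat_finite[OF finK] by (auto simp: atLeast0LessThan)
  have hp: "?h (prepend I ((A \<circ> e) k) x) = prepend I ((B \<circ> e) k) x" if "k < card K" "x \<in> ?X" for k x
  proof -
    have ek: "e k \<in> K" using e that by (auto simp: bij_betw_def)
    show ?thesis
      using prepend_in_subcube(2)[OF lA[OF ek] that(2)] fA[OF ek that(2)] gB[OF ek that(2)]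
      by (simp add: compose_def)
  qed
  have "homeomorphic_map (cantor_cube I \<Sigma>) (cantor_cube I \<Sigma>) (g \<circ> f)"
    using f g by (auto simp: rearrangements_def intro: homeomorphic_map_compose)
  then have "homeomorphic_map (cantor_cube I \<Sigma>) (cantor_cube I \<Sigma>) ?h"
    by (rule homeomorphic_map_eq) (simp add: compose_def)
  moreover have "subcube_partition I \<Sigma> (card K) (A \<circ> e)"
    by (rule subcube_partition_reindex[OF finK _ dA cA e]) (use lA in blast)
  moreover have "subcube_partition I \<Sigma> (card K) (B \<circ> e)"
    by (rule subcube_partition_reindex[OF finK _ dB cB e]) (use lB in blast)
  moreover have "?h \<in> extensional ?X" by (simp add: compose_def)
  ultimately show ?thesis using hp unfolding rearrangements_def by blast
qed

lemma rearrangements_one: "(\<lambda>x\<in>cantor_points I \<Sigma>. x) \<in> rearrangements I \<Sigma>"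
proof -
  let ?X = "cantor_points I \<Sigma>"
  have pr: "prepend I (\<lambda>_. []) x = x" if "x \<in> ?X" for x
    using that by (auto simp: prepend_def cantor_points_eq PiE_def extensional_def)
  have "subcube I \<Sigma> (\<lambda>_. []) = ?X" by (auto simp: subcube_def)
  then have "subcube_partition I \<Sigma> 1 (\<lambda>_ _. [])"
    by (auto simp: subcube_partition_def disjoint_family_on_def)
  moreover have "homeomorphic_map (cantor_cube I \<Sigma>) (cantor_cube I \<Sigma>) (\<lambda>x\<in>?X. x)"
    by (rule homeomorphic_map_eq[of _ _ id]) auto
  ultimately show ?thesis
    unfolding rearrangements_def using pr by fastforce
qed

lemma rearrangements_inv:
  assumes h: "h \<in> rearrangements I \<Sigma>"
  shows "(\<lambda>x\<in>cantor_points I \<Sigma>. inv_into (cantor_points I \<Sigma>) h x) \<in> rearrangements I \<Sigma>"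
proof -
  let ?X = "cantor_points I \<Sigma>"
  let ?T = "cantor_cube I \<Sigma>"
  let ?g = "\<lambda>x\<in>?X. inv_into ?X h x"
  obtain r \<alpha> \<beta> where pa: "subcube_partition I \<Sigma> r \<alpha>" and pb: "subcube_partition I \<Sigma> r \<beta>"
    and hp: "\<And>k x. k < r \<Longrightarrow> x \<in> ?X \<Longrightarrow> h (prepend I (\<alpha> k) x) = prepend I (\<beta> k) x"
    and hom: "homeomorphic_map ?T ?T h"
    using h unfolding rearrangements_def by blast
  have bij: "bij_betw h ?X ?X" using rearrangements_bij[OF h] by (simp add: Bij_def)
  obtain g where g: "homeomorphic_maps ?T ?T h g"
    using hom homeomorphic_map_maps by blast
  have "g x = ?g x" if "x \<in> ?X" for x
  proof -
    have "g x \<in> ?X" "h (g x) = x"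
      using g that by (auto simp: homeomorphic_maps_def continuous_map_def)
    then show ?thesis using bij that by (metis bij_betw_inv_into_left restrict_apply')
  qed
  moreover have "homeomorphic_map ?T ?T g"
    using g homeomorphic_maps_map by blast
  ultimately have "homeomorphic_map ?T ?T ?g"
    using homeomorphic_map_eq[of ?T ?T g ?g] by blast
  moreover have "?g (prepend I (\<beta> k) x) = prepend I (\<alpha> k) x" if "k < r" "x \<in> ?X" for k x
  proof -
    have "\<forall>i\<in>I. \<alpha> k i \<in> lists (\<Sigma> i)" "\<forall>i\<in>I. \<beta> k i \<in> lists (\<Sigma> i)"
      using pa pb that by (auto simp: subcube_partition_def)
    then show ?thesis
      using prepend_in_subcube(2) that bij hp[OF that] by (metis bij_betw_inv_into_left restrict_apply')
  qed
  moreover have "?g \<in> extensional ?X" by simp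
  ultimately show ?thesis using pa pb unfolding rearrangements_def by blast
qed

lemma group_rearrangement_group: "group (rearrangement_group I \<Sigma>)"
proof -
  let ?X = "cantor_points I \<Sigma>"
  interpret B: group "BijGroup ?X" by (rule group_BijGroup)
  have "subgroup (rearrangements I \<Sigma>) (BijGroup ?X)"
  proof (rule B.subgroupI)
    show "rearrangements I \<Sigma> \<subseteq> carrier (BijGroup ?X)"
      using rearrangements_bij by (auto simp: BijGroup_def)
    show "rearrangements I \<Sigma> \<noteq> {}" using rearrangements_one by blast
    show "inv\<^bsub>BijGroup ?X\<^esub> h \<in> rearrangements I \<Sigma>" if "h \<in> rearrangements I \<Sigma>" for h
      using rearrangements_inv[OF that] inv_BijGroup[OF rearrangements_bij[OF that]] by simp
    show "g \<otimes>\<^bsub>BijGroup ?X\<^esub> f \<in> rearrangements I \<Sigma>"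
      if "g \<in> rearrangements I \<Sigma>" "f \<in> rearrangements I \<Sigma>" for g f
      using rearrangements_compose[OF that] rearrangements_bij[OF that(1)] rearrangements_bij[OF that(2)]
      by (simp add: BijGroup_def)
  qed
  then show ?thesis
    unfolding rearrangement_group_def by (rule B.subgroup_imp_group)
qed


section \<open>The Cantor cube attached to a right-angled Artin group\<close>

datatype symbol = Bit nat | Idx nat | Blank

text \<open>Factor \<^term>\<open>Inl i\<close> is \<open>{0,1}\<^sup>\<omega>\<close>, factor \<^term>\<open>Inr {i, j}\<close> is \<open>{i,j,\<emptyset>}\<^sup>\<omega>\<close>, with \<^const>\<open>Blank\<close> as \<open>\<emptyset>\<close>.\<close>

fun raag_alphabet :: "nat + nat set \<Rightarrow> symbol set" where
  "raag_alphabet (Inl i) = {Bit 0, Bit 1}"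
| "raag_alphabet (Inr p) = insert Blank (Idx ` p)"

definition noncommuting_pairs :: "nat \<Rightarrow> (nat \<Rightarrow> 'v) \<Rightarrow> 'v set set \<Rightarrow> nat set set" where
  "noncommuting_pairs n v E =
    {{i, j} | i j. i \<in> {1..n} \<and> j \<in> {1..n} \<and>
       raag_gen n v E i \<otimes>\<^bsub>raag n v E\<^esub> raag_gen n v E j \<noteq>
       raag_gen n v E j \<otimes>\<^bsub>raag n v E\<^esub> raag_gen n v E i}"

end

theory Submission
  imports Defs
begin

text \<open>Every generator \<open>s\<close> is made to act on a Cantor cube by a bijection with an attracting subcube
  \<open>A(s)\<close> and a disjoint repelling subcube \<open>A(s\<^sup>-\<^sup>1)\<close>: everything outside \<open>A(s\<^sup>-\<^sup>1)\<close> is thrown into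
  \<open>A(s)\<close>. Two prefix insertions with disjoint images determine such a bijection
  (\<open>pole_shift\<close>), exchanging them inverts it, and it is a rearrangement
  (\<open>pole_shift_rearrangement\<close>) because it replaces prefixes locally with bounded depth
  (\<open>locally_prefix_replacement_rearrangement\<close>).

  The coordinates of the cube encode which generators commute. The words defining \<open>A(s)\<close> live in the
  coordinate of \<open>s\<close>, where they record the sign of the letter, and in the coordinates of the
  noncommuting pairs containing \<open>s\<close>, where they record \<open>s\<close>. Commuting generators therefore use
  disjoint sets of coordinates, so their actions commute and preserve each other's subcubes. The
  subcubes of noncommuting generators \<open>s\<close> and \<open>t\<close> are disjoint, since points of the two disagree in
  the coordinate of \<open>{s, t}\<close>. As no generator is central, each lies in some pair, and the point all
  of whose pair coordinates are \<open>\<emptyset>\<emptyset>\<emptyset>\<dots>\<close> lies in none of the subcubes.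

  These are the hypotheses of a ping-pong argument for groups presented by commutation relations
  (\<open>ping_pong\<close>): by induction on the length, a shortest word representing an element moves the base
  point into the subcube of its first letter, so a nontrivial element moves the base point.

  The cube enters only through an alphabet for each coordinate, code words with distinct first letters
  for the two members of a pair, and a symbol for the base point
  (\<open>coded_commutation_group_embeds\<close>). Taking one-letter codes over \<open>{i, j, \<emptyset>}\<close> gives the
  embedding into \<open>XV\<close>. Replacing \<open>i\<close>, \<open>j\<close>, \<open>\<emptyset>\<close> by the binary prefix code \<open>0\<close>, \<open>10\<close>, \<open>11\<close>
  gives the embedding into \<open>kV\<close>.\<close>


section \<open>Homomorphisms out of a presented group\<close>

definition letter_value :: "('g, 'm) monoid_scheme \<Rightarrow> ('s \<Rightarrow> 'g) \<Rightarrow> 's \<times> bool \<Rightarrow> 'g" where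
  "letter_value G \<rho> a = (if snd a then \<rho> (fst a) else inv\<^bsub>G\<^esub> \<rho> (fst a))"

primrec gword_value :: "('g, 'm) monoid_scheme \<Rightarrow> ('s \<Rightarrow> 'g) \<Rightarrow> 's gword \<Rightarrow> 'g" where
  "gword_value G \<rho> [] = \<one>\<^bsub>G\<^esub>"
| "gword_value G \<rho> (a # u) = letter_value G \<rho> a \<otimes>\<^bsub>G\<^esub> gword_value G \<rho> u"

context group
begin

lemma letter_value_closed:
  "\<rho> \<in> S \<rightarrow> carrier G \<Longrightarrow> fst a \<in> S \<Longrightarrow> letter_value G \<rho> a \<in> carrier G"
  by (auto simp: letter_value_def)

lemma gword_value_closed:
  assumes "\<rho> \<in> S \<rightarrow> carrier G" "u \<in> gwords S"
  shows "gword_value G \<rho> u \<in> carrier G"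
  using assms(2) by (induction u) (auto simp: gwords_def letter_value_closed[OF assms(1)])

lemma gword_value_append:
  assumes \<rho>: "\<rho> \<in> S \<rightarrow> carrier G" and u: "u \<in> gwords S" and w: "w \<in> gwords S"
  shows "gword_value G \<rho> (u @ w) = gword_value G \<rho> u \<otimes> gword_value G \<rho> w"
  using u
proof (induction u)
  case Nil
  then show ?case using gword_value_closed[OF \<rho> w] by simp
next
  case (Cons a u)
  then have "fst a \<in> S" "u \<in> gwords S" by (auto simp: gwords_def)
  then show ?case
    using Cons.IH letter_value_closed[OF \<rho>, of a] gword_value_closed[OF \<rho>, of u]
      gword_value_closed[OF \<rho> w] by (simp add: m_assoc)
qed

lemma gword_value_respects:
  assumes \<rho>: "\<rho> \<in> S \<rightarrow> carrier G"
    and rel: "\<forall>(l, r)\<in>R. l \<in> gwords S \<longrightarrow> r \<in> gwords S \<longrightarrow>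
      gword_value G \<rho> l = gword_value G \<rho> r"
    and eq: "gword_eq S R u w"
  shows "gword_value G \<rho> u = gword_value G \<rho> w"
  using eq
proof (induction rule: gword_eq.induct)
  case (cancel u w s b)
  have "[(s, b), (s, \<not> b)] @ w \<in> gwords S" "[(s, b), (s, \<not> b)] \<in> gwords S"
    using cancel by (auto simp: gwords_def)
  moreover have "gword_value G \<rho> [(s, b), (s, \<not> b)] = \<one>"
    using \<rho> cancel(3) by (auto simp: letter_value_def Pi_def)
  ultimately show ?case
    using gword_value_append[OF \<rho> cancel(1), of "[(s, b), (s, \<not> b)] @ w"]
      gword_value_append[OF \<rho> _ cancel(2), of "[(s, b), (s, \<not> b)]"]
      gword_value_append[OF \<rho> cancel(1,2)] gword_value_closed[OF \<rho> cancel(2)]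
    by (simp del: gword_value.simps)
next
  case (relation u w l r)
  have "l @ w \<in> gwords S" "r @ w \<in> gwords S"
    using relation by (auto simp: gwords_def)
  then show ?case
    using rel relation(3-5) gword_value_append[OF \<rho> relation(1), of "l @ w"]
      gword_value_append[OF \<rho> relation(1), of "r @ w"] gword_value_append[OF \<rho> relation(4,2)]
      gword_value_append[OF \<rho> relation(5,2)] by auto
qed auto

text \<open>Von Dyck's theorem together with its injectivity criterion: an assignment of values to the
  generators that satisfies the relations extends to the presented group, and the extension is
  injective as soon as only words that are trivial modulo the relations evaluate to the identity.\<close>

lemma presented_group_mon:
  assumes \<rho>: "\<rho> \<in> S \<rightarrow> carrier G"
    and rel: "\<forall>(l, r)\<in>R. l \<in> gwords S \<longrightarrow> r \<in> gwords S \<longrightarrow>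
      gword_value G \<rho> l = gword_value G \<rho> r"
    and faithful: "\<And>u. u \<in> gwords S \<Longrightarrow> gword_value G \<rho> u = \<one> \<Longrightarrow> gword_eq S R u []"
  shows "\<exists>f. f \<in> mon (presented_group S R) G"
proof -
  let ?H = "presented_group S R"
  let ?c = "\<lambda>u. gword_rel S R `` {u}"
  define f where "f A = gword_value G \<rho> (SOME u. u \<in> A)" for A
  have f: "f (?c u) = gword_value G \<rho> u" if "u \<in> gwords S" for u
  proof -
    have "u \<in> ?c u" using that by (auto simp: gword_rel_def intro: gword_eq.refl)
    then have "(SOME x. x \<in> ?c u) \<in> ?c u" by (rule someI)
    then have "gword_eq S R u (SOME x. x \<in> ?c u)" by (simp add: gword_rel_def)
    then have "gword_value G \<rho> u = gword_value G \<rho> (SOME x. x \<in> ?c u)"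
      by (rule gword_value_respects[OF \<rho> rel])
    then show ?thesis by (simp add: f_def)
  qed
  have rep: "\<exists>u\<in>gwords S. x = ?c u" if "x \<in> carrier ?H" for x
    using that by (auto simp: presented_group_def elim: quotientE)
  have app: "u @ w \<in> gwords S" if "u \<in> gwords S" "w \<in> gwords S" for u w
    using that by (auto simp: gwords_def)
  have "f \<in> hom ?H G"
  proof (rule homI)
    fix x y assume "x \<in> carrier ?H" "y \<in> carrier ?H"
    then obtain u w where "u \<in> gwords S" "x = ?c u" "w \<in> gwords S" "y = ?c w" using rep by metis
    then show "f (x \<otimes>\<^bsub>?H\<^esub> y) = f x \<otimes> f y"
      using f app gword_value_append[OF \<rho>, of u w] by (simp add: presented_group_mult)
  next
    fix x assume "x \<in> carrier ?H"
    then show "f x \<in> carrier G" using rep f gword_value_closed[OF \<rho>] by metis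
  qed
  moreover have "x = \<one>\<^bsub>?H\<^esub>" if x: "x \<in> carrier ?H" "f x = \<one>" for x
  proof -
    obtain u where u: "u \<in> gwords S" "x = ?c u" using rep x by blast
    then have "gword_eq S R u []" using faithful f x by simp
    then have "?c u = ?c []"
      by (intro equiv_class_eq[OF equiv_gword_rel]) (simp add: gword_rel_def)
    then show ?thesis using u by (simp add: presented_group_def)
  qed
  ultimately show ?thesis
    unfolding mon_iff_hom_one[OF group_presented_group is_group] by blast
qed

end


section \<open>Ping-pong for groups presented by commutation relations\<close>

text \<open>Conjugating \<open>st = ts\<close> by the inverse of \<open>s\<close> gives \<open>ts\<^sup>-\<^sup>1 = s\<^sup>-\<^sup>1t\<close>.\<close>

lemma commute_inverse_letter:
  assumes c: "gword_eq S R [(s, d), (t, e)] [(t, e), (s, d)]"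
  shows "gword_eq S R [(s, \<not> d), (t, e)] [(t, e), (s, \<not> d)]"
proof -
  have st: "s \<in> S" "t \<in> S" using gword_eq_in_gwords[OF c] by (auto simp: gwords_def)
  have "gword_eq S R ([(s, \<not> d), (t, e)] @ [(s, d), (s, \<not> d)] @ []) ([(s, \<not> d), (t, e)] @ [])"
    using st by (intro gword_eq.cancel) (auto simp: gwords_def)
  then have 1: "gword_eq S R [(s, \<not> d), (t, e)] [(s, \<not> d), (t, e), (s, d), (s, \<not> d)]"
    by (simp add: gword_eq.sym)
  have "gword_eq S R ([(s, \<not> d)] @ [(s, d), (t, e)] @ [(s, \<not> d)])
      ([(s, \<not> d)] @ [(t, e), (s, d)] @ [(s, \<not> d)])"
    using st by (intro gword_eq_context[OF c]) (auto simp: gwords_def)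
  then have 2: "gword_eq S R [(s, \<not> d), (t, e), (s, d), (s, \<not> d)]
      [(s, \<not> d), (s, d), (t, e), (s, \<not> d)]"
    by (simp add: gword_eq.sym)
  have "gword_eq S R ([] @ [(s, \<not> d), (s, \<not> \<not> d)] @ [(t, e), (s, \<not> d)])
      ([] @ [(t, e), (s, \<not> d)])"
    using st by (intro gword_eq.cancel) (auto simp: gwords_def)
  then have 3: "gword_eq S R [(s, \<not> d), (s, d), (t, e), (s, \<not> d)] [(t, e), (s, \<not> d)]"
    by simp
  show ?thesis by (rule gword_eq.trans[OF gword_eq.trans[OF 1 2] 3])
qed

definition generators_commute :: "'s set \<Rightarrow> ('s gword \<times> 's gword) set \<Rightarrow> 's \<Rightarrow> 's \<Rightarrow> bool" where
  "generators_commute S R s t \<longleftrightarrow> gword_eq S R [(s, True), (t, True)] [(t, True), (s, True)]"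

lemma generators_commute_sym: "generators_commute S R s t \<Longrightarrow> generators_commute S R t s"
  unfolding generators_commute_def by (rule gword_eq.sym)

lemma generators_commute_refl: "s \<in> S \<Longrightarrow> generators_commute S R s s"
  unfolding generators_commute_def by (rule gword_eq.refl) (simp add: gwords_def)

lemma generators_commute_letters:
  assumes "generators_commute S R s t"
  shows "gword_eq S R [(s, d), (t, e)] [(t, e), (s, d)]"
proof -
  have "gword_eq S R [(s, d), (t, True)] [(t, True), (s, d)]"
    using assms commute_inverse_letter[of S R s True t True]
    unfolding generators_commute_def by (cases d) auto
  then have "gword_eq S R [(t, True), (s, d)] [(s, d), (t, True)]" by (rule gword_eq.sym)
  then have "gword_eq S R [(t, e), (s, d)] [(s, d), (t, e)]"
    using commute_inverse_letter[of S R t True s d] by (cases e) auto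
  then show ?thesis by (rule gword_eq.sym)
qed

definition geodesic :: "'s set \<Rightarrow> ('s gword \<times> 's gword) set \<Rightarrow> 's gword \<Rightarrow> bool" where
  "geodesic S R u \<longleftrightarrow> u \<in> gwords S \<and> (\<forall>w. gword_eq S R u w \<longrightarrow> length u \<le> length w)"

lemma geodesic_exists:
  assumes "u \<in> gwords S"
  obtains w where "geodesic S R w" "gword_eq S R u w"
proof -
  obtain w where w: "gword_eq S R u w" "\<And>x. gword_eq S R u x \<Longrightarrow> length w \<le> length x"
    using ex_has_least_nat[of "gword_eq S R u" u length] gword_eq.refl[OF assms] by blast
  have "geodesic S R w"
    unfolding geodesic_def using w gword_eq_in_gwords gword_eq.trans by metis
  then show ?thesis using w that by blast
qed

lemma geodesic_tail:
  assumes "geodesic S R (a # u)"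
  shows "geodesic S R u"
proof -
  have au: "a # u \<in> gwords S" and min: "\<And>w. gword_eq S R (a # u) w \<Longrightarrow> length (a # u) \<le> length w"
    using assms unfolding geodesic_def by blast+
  have "length u \<le> length w" if w: "gword_eq S R u w" for w
  proof -
    have "gword_eq S R ([a] @ u @ []) ([a] @ w @ [])"
      using au by (intro gword_eq_context[OF w]) (auto simp: gwords_def)
    then show ?thesis using min[of "a # w"] by simp
  qed
  then show ?thesis using au by (auto simp: geodesic_def gwords_def)
qed

lemma geodesic_no_cancellation:
  assumes "geodesic S R ((s, d) # (s, e) # u)"
  shows "d = e"
proof (rule ccontr)
  assume "d \<noteq> e"
  then have e: "e = (\<not> d)" by blast
  have "s \<in> S" "u \<in> gwords S" using assms by (auto simp: geodesic_def gwords_def)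
  then have "gword_eq S R ([] @ [(s, d), (s, \<not> d)] @ u) ([] @ u)"
    by (intro gword_eq.cancel) (auto simp: gwords_def)
  then have "length ((s, d) # (s, e) # u) \<le> length u"
    using assms unfolding geodesic_def e by simp
  then show False by simp
qed

lemma geodesic_swap:
  assumes g: "geodesic S R (a # b # u)" and c: "gword_eq S R [a, b] [b, a]"
  shows "gword_eq S R (a # b # u) (b # a # u)" "geodesic S R (b # a # u)"
proof -
  have "u \<in> gwords S" using g by (auto simp: geodesic_def gwords_def)
  then show sw: "gword_eq S R (a # b # u) (b # a # u)"
    using gword_eq_context[OF c, of "[]" u] by (simp add: gwords_def)
  show "geodesic S R (b # a # u)"
    unfolding geodesic_def
  proof (intro conjI allI impI)
    show "b # a # u \<in> gwords S" using gword_eq_in_gwords[OF sw] by simp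
    fix w assume "gword_eq S R (b # a # u) w"
    then have "gword_eq S R (a # b # u) w" by (rule gword_eq.trans[OF sw])
    then show "length (b # a # u) \<le> length w" using g by (simp add: geodesic_def)
  qed
qed

text \<open>A letter throws everything outside the attracting set of its inverse into its own attracting
  set, and it preserves the attracting sets of the other generators that it commutes with. So a
  geodesic word moves the base point into the attracting set of its first letter. Passing from the
  tail \<open>b w\<close> to \<open>a b w\<close> needs a new argument only when \<open>a\<close> and \<open>b\<close> belong to distinct commuting
  generators: then \<open>b a w\<close> is geodesic too, so that the shorter word \<open>a w\<close> already sends the base
  point into the attracting set of \<open>a\<close>, which \<open>b\<close> preserves. Since the base point lies in no
  attracting set, a nonempty geodesic word moves it.\<close>

lemma (in group_action) ping_pong:
  fixes A :: "'s \<times> bool \<Rightarrow> 'c set"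
  assumes \<rho>: "\<rho> \<in> S \<rightarrow> carrier G"
    and rel: "\<forall>(l, r)\<in>R. l \<in> gwords S \<longrightarrow> r \<in> gwords S \<longrightarrow>
      gword_value G \<rho> l = gword_value G \<rho> r"
    and attract: "\<And>s e x. s \<in> S \<Longrightarrow> x \<in> E \<Longrightarrow> x \<notin> A (s, \<not> e) \<Longrightarrow>
      \<phi> (letter_value G \<rho> (s, e)) x \<in> A (s, e)"
    and opposite: "\<And>s. s \<in> S \<Longrightarrow> A (s, True) \<inter> A (s, False) = {}"
    and preserve: "\<And>s t d e x. s \<in> S \<Longrightarrow> t \<in> S \<Longrightarrow> s \<noteq> t \<Longrightarrow> generators_commute S R s t \<Longrightarrow>
      x \<in> E \<Longrightarrow> x \<in> A (s, d) \<Longrightarrow> \<phi> (letter_value G \<rho> (t, e)) x \<in> A (s, d)"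
    and separate: "\<And>s t d e. s \<in> S \<Longrightarrow> t \<in> S \<Longrightarrow> \<not> generators_commute S R s t \<Longrightarrow>
      A (s, d) \<inter> A (t, e) = {}"
    and base: "x\<^sub>0 \<in> E" "\<And>s e. s \<in> S \<Longrightarrow> x\<^sub>0 \<notin> A (s, e)"
    and u: "u \<in> gwords S" "gword_value G \<rho> u = \<one>"
  shows "gword_eq S R u []"
proof -
  interpret h: group_hom G "BijGroup E" \<phi> by (rule group_hom)
  let ?v = "gword_value G \<rho>"
  have closed: "?v w \<in> carrier G" if "w \<in> gwords S" for w
    using h.G.gword_value_closed[OF \<rho> that] .
  have inE: "\<phi> g x \<in> E" if "g \<in> carrier G" "x \<in> E" for g x
    using surj_prop[OF that(1)] that(2) by blast
  have one: "\<one>\<^bsub>BijGroup E\<^esub> x\<^sub>0 = x\<^sub>0" using base(1) by (simp add: BijGroup_def)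
  have step: "\<phi> (?v (a # w)) x\<^sub>0 = \<phi> (letter_value G \<rho> a) (\<phi> (?v w) x\<^sub>0)" if "a # w \<in> gwords S" for a w
  proof -
    have "fst a \<in> S" "w \<in> gwords S" using that by (auto simp: gwords_def)
    then show ?thesis
      using composition_rule[OF base(1) h.G.letter_value_closed[OF \<rho>] closed] by simp
  qed
  have respects: "?v w = ?v w'" if "gword_eq S R w w'" for w w'
    using h.G.gword_value_respects[OF \<rho> rel that] .
  have main: "\<phi> (?v ((s, d) # w)) x\<^sub>0 \<in> A (s, d)" if "geodesic S R ((s, d) # w)" for s d w
    using that
  proof (induction "length w" arbitrary: s d w rule: less_induct)
    case less
    have sw: "s \<in> S" "w \<in> gwords S" "(s, d) # w \<in> gwords S"
      using less.prems by (auto simp: geodesic_def gwords_def)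
    show ?case
    proof (cases w)
      case Nil
      then show ?thesis
        using attract[OF sw(1) base(1) base(2)[OF sw(1)]] step[OF sw(3)]
        by (simp add: one)
    next
      case (Cons b w')
      obtain t e where b: "b = (t, e)" by (cases b)
      have t: "t \<in> S" and w': "w' \<in> gwords S" using sw Cons b by (auto simp: gwords_def)
      define y where "y = \<phi> (?v w) x\<^sub>0"
      have yE: "y \<in> E" unfolding y_def using inE closed[OF sw(2)] base(1) by blast
      have y: "y \<in> A (t, e)"
        using less.hyps[of w' t e] geodesic_tail[OF less.prems] by (simp add: y_def Cons b)
      show ?thesis
      proof (cases "generators_commute S R s t \<and> s \<noteq> t")
        case False
        have "y \<notin> A (s, \<not> d)"
        proof (cases "s = t")
          case True
          then have "e = d" using less.prems geodesic_no_cancellation Cons b by metis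
          then show ?thesis using y True opposite[OF sw(1)] by (cases d) auto
        next
          case False
          then show ?thesis
            using y separate[OF sw(1) t] \<open>\<not> (generators_commute S R s t \<and> s \<noteq> t)\<close> by blast
        qed
        then show ?thesis
          using attract[OF sw(1) yE] step[OF sw(3)] by (simp add: y_def)
      next
        case True
        have geo: "geodesic S R ((s, d) # (t, e) # w')" using less.prems Cons b by simp
        note swap = geodesic_swap[OF geo generators_commute_letters[OF True[THEN conjunct1]]]
        have ts: "(t, e) # (s, d) # w' \<in> gwords S" and s': "(s, d) # w' \<in> gwords S"
          using sw t w' by (auto simp: gwords_def)
        have "\<phi> (?v ((s, d) # w')) x\<^sub>0 \<in> A (s, d)"
          using less.hyps[of w' s d] geodesic_tail[OF swap(2)] by (simp add: Cons)
        moreover have "\<phi> (?v ((s, d) # w')) x\<^sub>0 \<in> E"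
          using inE closed[OF s'] base(1) by blast
        ultimately have "\<phi> (?v ((t, e) # (s, d) # w')) x\<^sub>0 \<in> A (s, d)"
          using preserve[OF sw(1) t] True step[OF ts] by simp
        then show ?thesis using respects[OF swap(1)] by (simp only: Cons b)
      qed
    qed
  qed
  obtain w where w: "geodesic S R w" "gword_eq S R u w" using geodesic_exists[OF u(1)] .
  have "w = []"
  proof (rule ccontr)
    assume "w \<noteq> []"
    then obtain s d w' where eq: "w = (s, d) # w'" by (metis list.exhaust surj_pair)
    have "?v w = \<one>" using respects[OF w(2)] u(2) by simp
    then have "\<phi> (?v w) x\<^sub>0 = x\<^sub>0" by (simp add: one)
    then have "x\<^sub>0 \<in> A (s, d)" using main w(1) eq by metis
    moreover have "s \<in> S" using w(1) eq by (auto simp: geodesic_def gwords_def)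
    ultimately show False using base(2) by blast
  qed
  then show ?thesis using w(2) by simp
qed


section \<open>A bijection with a repelling and an attracting set\<close>

text \<open>Two injections \<open>a\<close> and \<open>b\<close> of \<open>U\<close> into itself with disjoint images determine a bijection of
  \<open>U\<close> that moves the whole complement of \<open>a U\<close> into \<open>b U\<close>. Applying \<open>b\<close> outside \<open>a U\<close> leaves
  \<open>U - b U\<close> and \<open>b (a U)\<close> to be covered by \<open>a U\<close>. These are hit by undoing \<open>a\<close> on \<open>a (U - b U)\<close>
  and by exchanging the order of the two injections on \<open>a (b U)\<close>.\<close>

definition pole_shift :: "'x set \<Rightarrow> ('x \<Rightarrow> 'x) \<Rightarrow> ('x \<Rightarrow> 'x) \<Rightarrow> 'x \<Rightarrow> 'x" where
  "pole_shift U a b = (\<lambda>x\<in>U. if x \<notin> a ` U then b x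
     else let y = inv_into U a x in if y \<notin> b ` U then y else b (a (inv_into U b y)))"

locale disjoint_embeddings =
  fixes U :: "'x set" and a b :: "'x \<Rightarrow> 'x"
  assumes a_in: "x \<in> U \<Longrightarrow> a x \<in> U" and b_in: "x \<in> U \<Longrightarrow> b x \<in> U"
    and inj_a: "inj_on a U" and inj_b: "inj_on b U"
    and disjoint: "a ` U \<inter> b ` U = {}"
begin

lemma flip: "disjoint_embeddings U b a"
  using a_in b_in inj_a inj_b disjoint by unfold_locales auto

lemma shift_outside: "x \<in> U \<Longrightarrow> x \<notin> a ` U \<Longrightarrow> pole_shift U a b x = b x"
  by (simp add: pole_shift_def)

lemma shift_inside: "y \<in> U \<Longrightarrow> y \<notin> b ` U \<Longrightarrow> pole_shift U a b (a y) = y"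
  by (simp add: pole_shift_def a_in inj_a)

lemma shift_deep: "z \<in> U \<Longrightarrow> pole_shift U a b (a (b z)) = b (a z)"
  by (simp add: pole_shift_def a_in b_in inj_a inj_b)

lemma shift_cases:
  assumes "x \<in> U"
  obtains (outside) "x \<notin> a ` U" | (inside) y where "y \<in> U" "y \<notin> b ` U" "x = a y"
    | (deep) z where "z \<in> U" "x = a (b z)"
  using assms by blast

lemma shift_in: "x \<in> U \<Longrightarrow> pole_shift U a b x \<in> U"
  by (cases x rule: shift_cases) (auto simp: shift_outside shift_inside shift_deep a_in b_in)

lemma shift_inverse:
  assumes "x \<in> U"
  shows "pole_shift U b a (pole_shift U a b x) = x"
proof -
  interpret flipped: disjoint_embeddings U b a by (rule flip)
  show ?thesis
    using assms
  proof (cases rule: shift_cases)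
    case outside
    then show ?thesis using assms by (simp add: shift_outside flipped.shift_inside)
  next
    case (inside y)
    then show ?thesis by (simp add: shift_inside flipped.shift_outside)
  next
    case (deep z)
    then show ?thesis by (simp add: shift_deep flipped.shift_deep)
  qed
qed

lemma shift_bij: "bij_betw (pole_shift U a b) U U"
proof -
  interpret flipped: disjoint_embeddings U b a by (rule flip)
  show ?thesis
    by (rule bij_betw_byWitness[of _ "pole_shift U b a"])
      (auto simp: shift_inverse flipped.shift_inverse shift_in flipped.shift_in)
qed

text \<open>A map commuting with both injections commutes with the shift as soon as it respects the case
  distinction in its definition, that is, reflects membership in the two images.\<close>

lemma shift_commute:
  assumes f_in: "\<And>x. x \<in> U \<Longrightarrow> f x \<in> U"
    and fa: "\<And>x. x \<in> U \<Longrightarrow> f (a x) = a (f x)" and fb: "\<And>x. x \<in> U \<Longrightarrow> f (b x) = b (f x)"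
    and ra: "\<And>x. x \<in> U \<Longrightarrow> f x \<in> a ` U \<Longrightarrow> x \<in> a ` U"
    and rb: "\<And>x. x \<in> U \<Longrightarrow> f x \<in> b ` U \<Longrightarrow> x \<in> b ` U"
    and x: "x \<in> U"
  shows "f (pole_shift U a b x) = pole_shift U a b (f x)"
  using x
proof (cases rule: shift_cases)
  case outside
  then have "f x \<notin> a ` U" using ra x by blast
  then show ?thesis using outside x f_in fb by (simp add: shift_outside)
next
  case (inside y)
  then have "f y \<notin> b ` U" using rb by blast
  then show ?thesis using inside f_in fa by (simp add: shift_inside)
next
  case (deep z)
  then show ?thesis using f_in fa fb a_in b_in by (simp add: shift_deep)
qed

end


section \<open>Recognising rearrangements\<close>

lemma continuous_map_prepend:
  assumes "\<forall>i\<in>I. \<alpha> i \<in> lists (\<Sigma> i)"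
  shows "continuous_map (cantor_cube I \<Sigma>) (cantor_cube I \<Sigma>) (prepend I \<alpha>)"
proof -
  let ?D = "\<lambda>i. product_topology (\<lambda>_::nat. discrete_topology (\<Sigma> i)) UNIV"
  have "continuous_map (cantor_cube I \<Sigma>) (discrete_topology (\<Sigma> i)) (\<lambda>x. (\<alpha> i \<frown> x i) n)"
    if i: "i \<in> I" for i n
  proof (cases "n < length (\<alpha> i)")
    case True
    then have "\<alpha> i ! n \<in> \<Sigma> i" using assms i by (auto simp: in_lists_conv_set)
    then show ?thesis using True by simp
  next
    case False
    have "continuous_map (cantor_cube I \<Sigma>) (?D i) (\<lambda>x. x i)"
      unfolding cantor_cube_def by (rule continuous_map_product_projection[OF i])
    moreover have "continuous_map (?D i) (discrete_topology (\<Sigma> i)) (\<lambda>z. z (n - length (\<alpha> i)))"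
      by (rule continuous_map_product_projection) simp
    ultimately have "continuous_map (cantor_cube I \<Sigma>) (discrete_topology (\<Sigma> i))
        ((\<lambda>z. z (n - length (\<alpha> i))) \<circ> (\<lambda>x. x i))"
      by (rule continuous_map_compose)
    then show ?thesis using False by (simp add: comp_def)
  qed
  then have "continuous_map (cantor_cube I \<Sigma>) (?D i) (\<lambda>x. \<alpha> i \<frown> x i)" if "i \<in> I" for i
    using that by (simp add: continuous_map_componentwise_UNIV)
  moreover have "continuous_map (cantor_cube I \<Sigma>) (?D i) (\<lambda>x. prepend I \<alpha> x i) \<longleftrightarrow>
      continuous_map (cantor_cube I \<Sigma>) (?D i) (\<lambda>x. \<alpha> i \<frown> x i)" if "i \<in> I" for i
    using that by (simp add: prepend_def)
  ultimately show ?thesis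
    unfolding cantor_cube_def[of I \<Sigma>]
    by (subst continuous_map_componentwise) (auto simp: prepend_def cantor_cube_def)
qed

lemma compact_Hausdorff_cantor_cube:
  assumes "\<forall>i\<in>I. finite (\<Sigma> i)"
  shows "compact_space (cantor_cube I \<Sigma>)" "Hausdorff_space (cantor_cube I \<Sigma>)"
  unfolding cantor_cube_def using assms
  by (auto simp: compact_space_product_topology compact_space_discrete_topology
      Hausdorff_space_product_topology Hausdorff_space_discrete_topology)

text \<open>Preimages of closed sets are finite unions of images of closed sets under prefix insertions,
  which are closed maps because the Cantor cube is compact and Hausdorff.\<close>

lemma piecewise_prefix_replacement_continuous:
  assumes fin: "\<forall>i\<in>I. finite (\<Sigma> i)" and K: "finite K"
    and words: "\<forall>k\<in>K. \<forall>i\<in>I. \<alpha> k i \<in> lists (\<Sigma> i)" "\<forall>k\<in>K. \<forall>i\<in>I. \<beta> k i \<in> lists (\<Sigma> i)"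
    and cover: "(\<Union>k\<in>K. subcube I \<Sigma> (\<alpha> k)) = cantor_points I \<Sigma>"
    and h: "\<forall>k\<in>K. \<forall>x\<in>cantor_points I \<Sigma>. h (prepend I (\<alpha> k) x) = prepend I (\<beta> k) x"
  shows "continuous_map (cantor_cube I \<Sigma>) (cantor_cube I \<Sigma>) h"
proof -
  let ?T = "cantor_cube I \<Sigma>" and ?X = "cantor_points I \<Sigma>"
  have pieces: "\<exists>k\<in>K. \<exists>y\<in>?X. x = prepend I (\<alpha> k) y" if "x \<in> ?X" for x
    using that cover subcube_eq_prepend[OF bspec[OF words(1)]] by blast
  have h_in: "h x \<in> ?X" if x: "x \<in> ?X" for x
  proof -
    obtain k y where "k \<in> K" "y \<in> ?X" "x = prepend I (\<alpha> k) y" using pieces[OF x] by blast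
    then show ?thesis using h prepend_in_subcube(2)[OF bspec[OF words(2)]] by simp
  qed
  have "closedin ?T {x \<in> ?X. h x \<in> C}" if C: "closedin ?T C" for C
  proof -
    let ?P = "\<lambda>k. prepend I (\<alpha> k) ` {y \<in> ?X. prepend I (\<beta> k) y \<in> C}"
    have "closedin ?T (?P k)" if k: "k \<in> K" for k
    proof -
      have "closed_map ?T ?T (prepend I (\<alpha> k))"
        using continuous_imp_closed_map compact_Hausdorff_cantor_cube[OF fin]
          continuous_map_prepend[OF bspec[OF words(1) k]] by blast
      moreover have "closedin ?T {y \<in> ?X. prepend I (\<beta> k) y \<in> C}"
        using continuous_map_prepend[OF bspec[OF words(2) k]] C
        by (simp add: continuous_map_closedin)
      ultimately show ?thesis by (simp add: closed_map_def)
    qed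
    then have "closedin ?T (\<Union>k\<in>K. ?P k)" using K by (intro closedin_Union) auto
    moreover have "{x \<in> ?X. h x \<in> C} = (\<Union>k\<in>K. ?P k)"
    proof (intro equalityI subsetI)
      fix x assume x: "x \<in> {x \<in> ?X. h x \<in> C}"
      then obtain k y where "k \<in> K" "y \<in> ?X" "x = prepend I (\<alpha> k) y" using pieces by blast
      then show "x \<in> (\<Union>k\<in>K. ?P k)" using x h by auto
    next
      fix x assume "x \<in> (\<Union>k\<in>K. ?P k)"
      then show "x \<in> {x \<in> ?X. h x \<in> C}" using h prepend_in_subcube(2)[OF bspec[OF words(1)]] by auto
    qed
    ultimately show ?thesis by simp
  qed
  then show ?thesis using h_in by (auto simp: continuous_map_closedin)
qed

text \<open>For a bijection it is enough to find, around every point, some subcube of bounded depth on which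
  it replaces a prefix: cutting the cube into all subcubes of that depth gives a partition, the
  bijection carries it to a second partition, and compactness supplies the homeomorphism.\<close>

lemma locally_prefix_replacement_rearrangement:
  assumes I: "finite I" and fin: "\<forall>i\<in>I. finite (\<Sigma> i)"
    and ext: "h \<in> extensional (cantor_points I \<Sigma>)"
    and bij: "bij_betw h (cantor_points I \<Sigma>) (cantor_points I \<Sigma>)"
    and local: "\<And>x. x \<in> cantor_points I \<Sigma> \<Longrightarrow>
      \<exists>\<alpha> \<beta>. (\<forall>i\<in>I. \<alpha> i \<in> lists (\<Sigma> i) \<and> length (\<alpha> i) \<le> L) \<and> (\<forall>i\<in>I. \<beta> i \<in> lists (\<Sigma> i)) \<and>
        x \<in> subcube I \<Sigma> \<alpha> \<and> (\<forall>y\<in>cantor_points I \<Sigma>. h (prepend I \<alpha> y) = prepend I \<beta> y)"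
  shows "h \<in> rearrangements I \<Sigma>"
proof -
  let ?T = "cantor_cube I \<Sigma>" and ?X = "cantor_points I \<Sigma>"
  define truncate where "truncate x = (\<lambda>i\<in>I. Omega_Words_Fun.prefix L (x i))" for x :: "'a \<Rightarrow> 'b word"
  define K where "K = truncate ` ?X"
  have range: "range (x i) \<subseteq> \<Sigma> i" if "x \<in> ?X" "i \<in> I" for x i
    using that by (auto simp: cantor_points_eq)
  have words: "\<forall>i\<in>I. \<gamma> i \<in> lists (\<Sigma> i)" if "\<gamma> \<in> K" for \<gamma>
    using that range by (fastforce simp: K_def truncate_def in_lists_conv_set)
  have K: "finite K"
  proof (rule finite_subset)
    show "K \<subseteq> (\<Pi>\<^sub>E i\<in>I. {u. set u \<subseteq> \<Sigma> i \<and> length u = L})"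
      using range by (fastforce simp: K_def truncate_def)
    show "finite (\<Pi>\<^sub>E i\<in>I. {u. set u \<subseteq> \<Sigma> i \<and> length u = L})"
      using I fin by (intro finite_PiE finite_lists_length_eq) auto
  qed
  have mem: "x \<in> subcube I \<Sigma> \<gamma> \<longleftrightarrow> x \<in> ?X \<and> truncate x = \<gamma>" if "\<gamma> \<in> K" for x \<gamma>
  proof -
    have "length (\<gamma> i) = L" if "i \<in> I" for i using that \<open>\<gamma> \<in> K\<close> by (auto simp: K_def truncate_def)
    moreover have "\<gamma> \<in> extensional I" using that by (auto simp: K_def truncate_def)
    ultimately have "(\<forall>i\<in>I. Omega_Words_Fun.prefix (length (\<gamma> i)) (x i) = \<gamma> i) \<longleftrightarrow> truncate x = \<gamma>"
      by (auto simp: truncate_def extensional_def)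
    then show ?thesis by (simp add: subcube_def)
  qed
  have "\<exists>\<beta>. (\<forall>i\<in>I. \<beta> i \<in> lists (\<Sigma> i)) \<and> (\<forall>y\<in>?X. h (prepend I \<gamma> y) = prepend I \<beta> y)"
    if \<gamma>: "\<gamma> \<in> K" for \<gamma>
  proof -
    obtain x where x: "x \<in> ?X" "\<gamma> = truncate x" using \<gamma> by (auto simp: K_def)
    obtain \<alpha> \<beta> where ab: "\<forall>i\<in>I. \<alpha> i \<in> lists (\<Sigma> i) \<and> length (\<alpha> i) \<le> L" "\<forall>i\<in>I. \<beta> i \<in> lists (\<Sigma> i)"
      "x \<in> subcube I \<Sigma> \<alpha>" "\<forall>y\<in>?X. h (prepend I \<alpha> y) = prepend I \<beta> y"
      using local[OF x(1)] by blast
    define \<delta> where "\<delta> i = drop (length (\<alpha> i)) (\<gamma> i)" for i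
    have "take (length (\<alpha> i)) (\<gamma> i) = \<alpha> i" if "i \<in> I" for i
      using ab(1,3) that by (simp add: x(2) truncate_def subcube_def min_absorb1)
    then have \<gamma>': "\<forall>i\<in>I. \<gamma> i = \<alpha> i @ \<delta> i" unfolding \<delta>_def by (metis append_take_drop_id)
    then have \<delta>: "\<forall>i\<in>I. \<delta> i \<in> lists (\<Sigma> i)" using words[OF \<gamma>] by (metis append_in_lists_conv)
    have "h (prepend I \<gamma> y) = prepend I (\<lambda>i. \<beta> i @ \<delta> i) y" if "y \<in> ?X" for y
      using ab(4) prepend_in_subcube(2)[OF \<delta> that] prepend_append[OF \<gamma>', of y]
        prepend_append[of I "\<lambda>i. \<beta> i @ \<delta> i" \<beta> \<delta> y] by simp
    then show ?thesis using ab(2) \<delta> by (intro exI[of _ "\<lambda>i. \<beta> i @ \<delta> i"]) simp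
  qed
  then have "\<forall>\<gamma>\<in>K. \<exists>\<beta>. (\<forall>i\<in>I. \<beta> i \<in> lists (\<Sigma> i)) \<and> (\<forall>y\<in>?X. h (prepend I \<gamma> y) = prepend I \<beta> y)"
    by blast
  then obtain B where "\<forall>\<gamma>\<in>K. (\<forall>i\<in>I. B \<gamma> i \<in> lists (\<Sigma> i)) \<and> (\<forall>y\<in>?X. h (prepend I \<gamma> y) = prepend I (B \<gamma>) y)"
    by (rule bchoice[THEN exE])
  then have Bw: "\<forall>i\<in>I. B \<gamma> i \<in> lists (\<Sigma> i)" and hB: "y \<in> ?X \<Longrightarrow> h (prepend I \<gamma> y) = prepend I (B \<gamma>) y"
    if "\<gamma> \<in> K" for \<gamma> y using that by blast+
  have dom_disjoint: "disjoint_family_on (\<lambda>\<gamma>. subcube I \<Sigma> \<gamma>) K"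
    using mem by (auto simp: disjoint_family_on_def)
  have dom_cover: "(\<Union>\<gamma>\<in>K. subcube I \<Sigma> \<gamma>) = ?X"
    using mem by (auto simp: K_def)
  have img: "subcube I \<Sigma> (B \<gamma>) = h ` subcube I \<Sigma> \<gamma>" if "\<gamma> \<in> K" for \<gamma>
    using hB[OF that] by (auto simp: subcube_eq_prepend[OF words[OF that]] subcube_eq_prepend[OF Bw[OF that]]
        image_image)
  have sub: "subcube I \<Sigma> \<gamma> \<subseteq> ?X" for \<gamma> by (auto simp: subcube_def)
  have ran_disjoint: "disjoint_family_on (\<lambda>\<gamma>. subcube I \<Sigma> (B \<gamma>)) K"
    unfolding disjoint_family_on_def
  proof (intro ballI impI)
    fix \<gamma> \<gamma>' assume g: "\<gamma> \<in> K" "\<gamma>' \<in> K" "\<gamma> \<noteq> \<gamma>'"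
    then have "h ` (subcube I \<Sigma> \<gamma> \<inter> subcube I \<Sigma> \<gamma>') = h ` subcube I \<Sigma> \<gamma> \<inter> h ` subcube I \<Sigma> \<gamma>'"
      using inj_on_image_Int[OF bij_betw_imp_inj_on[OF bij] sub sub] by blast
    then show "subcube I \<Sigma> (B \<gamma>) \<inter> subcube I \<Sigma> (B \<gamma>') = {}"
      using g dom_disjoint img by (simp add: disjoint_family_on_def)
  qed
  have "(\<Union>\<gamma>\<in>K. subcube I \<Sigma> (B \<gamma>)) = h ` (\<Union>\<gamma>\<in>K. subcube I \<Sigma> \<gamma>)" using img by auto
  then have ran_cover: "(\<Union>\<gamma>\<in>K. subcube I \<Sigma> (B \<gamma>)) = ?X"
    using bij_betw_imp_surj_on[OF bij] by (simp only: dom_cover)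
  obtain e where e: "bij_betw e {..<card K} K"
    using ex_bij_betw_nat_finite[OF K] by (auto simp: atLeast0LessThan)
  have "subcube_partition I \<Sigma> (card K) ((\<lambda>\<gamma>. \<gamma>) \<circ> e)"
    by (rule subcube_partition_reindex[OF K _ dom_disjoint dom_cover e]) (use words in blast)
  moreover have "subcube_partition I \<Sigma> (card K) (B \<circ> e)"
    by (rule subcube_partition_reindex[OF K _ ran_disjoint ran_cover e]) (use Bw in blast)
  moreover have "h (prepend I (((\<lambda>\<gamma>. \<gamma>) \<circ> e) k) x) = prepend I ((B \<circ> e) k) x"
    if "k < card K" "x \<in> ?X" for k x
    using hB bij_betw_apply[OF e] that by simp
  moreover have "homeomorphic_map ?T ?T h"
  proof (rule continuous_imp_homeomorphic_map)
    show "continuous_map ?T ?T h"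
      by (rule piecewise_prefix_replacement_continuous[where \<beta> = B, OF fin K _ _ dom_cover])
        (use words Bw hB in blast)+
  qed (use compact_Hausdorff_cantor_cube[OF fin] bij in \<open>auto simp: bij_betw_def\<close>)
  ultimately show ?thesis using ext unfolding rearrangements_def by blast
qed


section \<open>Pole shifts of Cantor cubes\<close>

lemma prepend_inj: "inj_on (prepend I \<alpha>) (cantor_points I \<Sigma>)"
proof (rule inj_onI)
  fix x y assume xy: "x \<in> cantor_points I \<Sigma>" "y \<in> cantor_points I \<Sigma>" "prepend I \<alpha> x = prepend I \<alpha> y"
  have "x i = y i" if "i \<in> I" for i
    using fun_cong[OF xy(3), of i] that by (simp add: prepend_def)
  then show "x = y" using xy(1,2) by (auto simp: cantor_points_eq intro: PiE_ext)
qed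

text \<open>Words with disjoint supports touch different coordinates of the cube.\<close>

lemma prepend_disjoint_support:
  assumes "\<forall>i\<in>I. \<alpha> i = [] \<or> \<beta> i = []"
  shows "prepend I \<alpha> (prepend I \<beta> x) = prepend I \<beta> (prepend I \<alpha> x)"
    and "x \<in> cantor_points I \<Sigma> \<Longrightarrow> prepend I \<beta> x \<in> subcube I \<Sigma> \<alpha> \<Longrightarrow> x \<in> subcube I \<Sigma> \<alpha>"
proof -
  show "prepend I \<alpha> (prepend I \<beta> x) = prepend I \<beta> (prepend I \<alpha> x)"
    using assms by (fastforce simp: prepend_def)
  assume x: "x \<in> cantor_points I \<Sigma>" and p: "prepend I \<beta> x \<in> subcube I \<Sigma> \<alpha>"
  have "Omega_Words_Fun.prefix (length (\<alpha> i)) (x i) = \<alpha> i" if "i \<in> I" for i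
  proof (cases "\<alpha> i = []")
    case False
    then have "prepend I \<beta> x i = x i" using assms that by (auto simp: prepend_def)
    then show ?thesis using p that by (auto simp: subcube_def)
  qed simp
  then show "x \<in> subcube I \<Sigma> \<alpha>" using x by (simp add: subcube_def)
qed

text \<open>Outside a subcube of depth at most \<open>l\<close>, the truncation of a point to depth \<open>l\<close> already witnesses
  that the point is outside.\<close>

lemma outside_subcube_truncation:
  assumes x: "x \<in> cantor_points I \<Sigma>" "x \<notin> subcube I \<Sigma> \<alpha>" and l: "\<forall>i\<in>I. length (\<alpha> i) \<le> l"
  obtains \<gamma> where "\<forall>i\<in>I. \<gamma> i \<in> lists (\<Sigma> i) \<and> length (\<gamma> i) = l" "x \<in> subcube I \<Sigma> \<gamma>"
    "subcube I \<Sigma> \<gamma> \<inter> subcube I \<Sigma> \<alpha> = {}"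
proof -
  define \<gamma> where "\<gamma> i = Omega_Words_Fun.prefix l (x i)" for i
  have "\<forall>i\<in>I. \<gamma> i \<in> lists (\<Sigma> i) \<and> length (\<gamma> i) = l"
    using x(1) by (fastforce simp: \<gamma>_def cantor_points_eq in_lists_conv_set)
  moreover have "x \<in> subcube I \<Sigma> \<gamma>" using x(1) by (simp add: subcube_def \<gamma>_def)
  moreover have "y \<notin> subcube I \<Sigma> \<alpha>" if y: "y \<in> subcube I \<Sigma> \<gamma>" for y
  proof
    assume y': "y \<in> subcube I \<Sigma> \<alpha>"
    have "Omega_Words_Fun.prefix (length (\<alpha> i)) (x i) = \<alpha> i" if i: "i \<in> I" for i
    proof -
      have "take (length (\<alpha> i)) (Omega_Words_Fun.prefix l (x i)) =
          take (length (\<alpha> i)) (Omega_Words_Fun.prefix l (y i))"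
        using y i by (simp add: subcube_def \<gamma>_def)
      then show ?thesis using y' i l by (simp add: subcube_def min_absorb1)
    qed
    then show False using x by (simp add: subcube_def)
  qed
  ultimately show ?thesis using that by blast
qed

lemma prepend_disjoint_embeddings:
  assumes "\<forall>i\<in>I. \<alpha> i \<in> lists (\<Sigma> i)" "\<forall>i\<in>I. \<beta> i \<in> lists (\<Sigma> i)"
    and "subcube I \<Sigma> \<alpha> \<inter> subcube I \<Sigma> \<beta> = {}"
  shows "disjoint_embeddings (cantor_points I \<Sigma>) (prepend I \<alpha>) (prepend I \<beta>)"
  using assms prepend_in_subcube(2) prepend_inj by unfold_locales (simp_all add: subcube_eq_prepend)

text \<open>On each of the three regions in its definition a pole shift replaces prefixes; the two regions
  that are not subcubes are cut into subcubes by truncating points.\<close>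

lemma pole_shift_rearrangement:
  assumes I: "finite I" and fin: "\<forall>i\<in>I. finite (\<Sigma> i)"
    and \<alpha>: "\<forall>i\<in>I. \<alpha> i \<in> lists (\<Sigma> i)" and \<beta>: "\<forall>i\<in>I. \<beta> i \<in> lists (\<Sigma> i)"
    and disj: "subcube I \<Sigma> \<alpha> \<inter> subcube I \<Sigma> \<beta> = {}"
  shows "pole_shift (cantor_points I \<Sigma>) (prepend I \<alpha>) (prepend I \<beta>) \<in> rearrangements I \<Sigma>"
proof -
  let ?X = "cantor_points I \<Sigma>"
  let ?h = "pole_shift ?X (prepend I \<alpha>) (prepend I \<beta>)"
  interpret disjoint_embeddings ?X "prepend I \<alpha>" "prepend I \<beta>"
    by (rule prepend_disjoint_embeddings[OF \<alpha> \<beta> disj])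
  have img: "prepend I \<alpha> ` ?X = subcube I \<Sigma> \<alpha>" "prepend I \<beta> ` ?X = subcube I \<Sigma> \<beta>"
    using subcube_eq_prepend \<alpha> \<beta> by blast+
  define l where "l = Max (insert 0 ((\<lambda>i. length (\<alpha> i)) ` I \<union> (\<lambda>i. length (\<beta> i)) ` I))"
  have l: "\<forall>i\<in>I. length (\<alpha> i) \<le> l" "\<forall>i\<in>I. length (\<beta> i) \<le> l"
    unfolding l_def using I by (auto intro!: Max_ge)
  have local: "\<exists>\<alpha>' \<beta>'. (\<forall>i\<in>I. \<alpha>' i \<in> lists (\<Sigma> i) \<and> length (\<alpha>' i) \<le> 2 * l) \<and> (\<forall>i\<in>I. \<beta>' i \<in> lists (\<Sigma> i)) \<and>
      x \<in> subcube I \<Sigma> \<alpha>' \<and> (\<forall>y\<in>?X. ?h (prepend I \<alpha>' y) = prepend I \<beta>' y)"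
    if x: "x \<in> ?X" for x
    using x
  proof (cases rule: shift_cases)
    case outside
    then obtain \<gamma> where \<gamma>: "\<forall>i\<in>I. \<gamma> i \<in> lists (\<Sigma> i) \<and> length (\<gamma> i) = l" "x \<in> subcube I \<Sigma> \<gamma>"
      "subcube I \<Sigma> \<gamma> \<inter> subcube I \<Sigma> \<alpha> = {}"
      using outside_subcube_truncation[OF x _ l(1)] img(1) by metis
    have \<gamma>w: "\<forall>i\<in>I. \<gamma> i \<in> lists (\<Sigma> i)" using \<gamma>(1) by blast
    have app: "prepend I (\<lambda>i. \<beta> i @ \<gamma> i) y = prepend I \<beta> (prepend I \<gamma> y)" for y
      by (rule prepend_append) simp
    have shift: "?h (prepend I \<gamma> y) = prepend I (\<lambda>i. \<beta> i @ \<gamma> i) y" if y: "y \<in> ?X" for y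
    proof -
      have "prepend I \<gamma> y \<notin> prepend I \<alpha> ` ?X"
        using prepend_in_subcube(1)[OF \<gamma>w y] \<gamma>(3) img(1) by blast
      then show ?thesis
        unfolding app by (rule shift_outside[OF prepend_in_subcube(2)[OF \<gamma>w y]])
    qed
    have len: "\<forall>i\<in>I. \<gamma> i \<in> lists (\<Sigma> i) \<and> length (\<gamma> i) \<le> 2 * l" using \<gamma>(1) by simp
    have "\<forall>i\<in>I. \<beta> i @ \<gamma> i \<in> lists (\<Sigma> i)" using \<gamma>w \<beta> by simp
    with len \<gamma>(2) shift show ?thesis by (intro exI conjI) (assumption, assumption, assumption, blast)
  next
    case (inside y)
    then obtain \<gamma> where \<gamma>: "\<forall>i\<in>I. \<gamma> i \<in> lists (\<Sigma> i) \<and> length (\<gamma> i) = l" "y \<in> subcube I \<Sigma> \<gamma>"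
      "subcube I \<Sigma> \<gamma> \<inter> subcube I \<Sigma> \<beta> = {}"
      using outside_subcube_truncation[OF _ _ l(2)] img(2) by metis
    have \<gamma>w: "\<forall>i\<in>I. \<gamma> i \<in> lists (\<Sigma> i)" using \<gamma>(1) by blast
    have app: "prepend I (\<lambda>i. \<alpha> i @ \<gamma> i) z = prepend I \<alpha> (prepend I \<gamma> z)" for z
      by (rule prepend_append) simp
    have shift: "?h (prepend I (\<lambda>i. \<alpha> i @ \<gamma> i) z) = prepend I \<gamma> z" if z: "z \<in> ?X" for z
    proof -
      have "prepend I \<gamma> z \<notin> prepend I \<beta> ` ?X"
        using prepend_in_subcube(1)[OF \<gamma>w z] \<gamma>(3) img(2) by blast
      then show ?thesis
        unfolding app by (rule shift_inside[OF prepend_in_subcube(2)[OF \<gamma>w z]])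
    qed
    have mem: "x \<in> subcube I \<Sigma> (\<lambda>i. \<alpha> i @ \<gamma> i)"
    proof -
      obtain z where "z \<in> ?X" "y = prepend I \<gamma> z"
        using \<gamma>(2) subcube_eq_prepend[OF \<gamma>w] by blast
      then have "x = prepend I (\<lambda>i. \<alpha> i @ \<gamma> i) z" using inside by (simp add: app)
      then show ?thesis
        using prepend_in_subcube(1)[of I "\<lambda>i. \<alpha> i @ \<gamma> i" \<Sigma> z] \<alpha> \<gamma>w \<open>z \<in> ?X\<close> by simp
    qed
    have "\<forall>i\<in>I. \<alpha> i @ \<gamma> i \<in> lists (\<Sigma> i) \<and> length (\<alpha> i @ \<gamma> i) \<le> 2 * l"
      using \<gamma>(1) \<alpha> l(1) by (simp add: mult_2)
    with \<gamma>w mem shift show ?thesis by (intro exI conjI) (assumption, assumption, assumption, blast)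
  next
    case (deep z)
    have app: "prepend I (\<lambda>i. \<alpha> i @ \<beta> i) z = prepend I \<alpha> (prepend I \<beta> z)"
      "prepend I (\<lambda>i. \<beta> i @ \<alpha> i) z = prepend I \<beta> (prepend I \<alpha> z)" for z
      by (rule prepend_append, simp)+
    have mem: "x \<in> subcube I \<Sigma> (\<lambda>i. \<alpha> i @ \<beta> i)"
      using prepend_in_subcube(1)[of I "\<lambda>i. \<alpha> i @ \<beta> i" \<Sigma> z] \<alpha> \<beta> deep by (simp add: app)
    have shift: "?h (prepend I (\<lambda>i. \<alpha> i @ \<beta> i) z) = prepend I (\<lambda>i. \<beta> i @ \<alpha> i) z" if "z \<in> ?X" for z
      unfolding app by (rule shift_deep[OF that])
    have "\<forall>i\<in>I. \<alpha> i @ \<beta> i \<in> lists (\<Sigma> i) \<and> length (\<alpha> i @ \<beta> i) \<le> 2 * l"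
      "\<forall>i\<in>I. \<beta> i @ \<alpha> i \<in> lists (\<Sigma> i)"
      using \<alpha> \<beta> l by (simp_all add: add_mono mult_2)
    with mem shift show ?thesis by (intro exI conjI) (assumption, assumption, assumption, blast)
  qed
  have ext: "?h \<in> extensional ?X" by (simp add: pole_shift_def)
  show ?thesis
    by (rule locally_prefix_replacement_rearrangement[OF I fin ext shift_bij]) (rule local)
qed


section \<open>Embedding groups with commutation relations into rearrangement groups\<close>

lemma group_action_rearrangement_group:
  "group_action (rearrangement_group I \<Sigma>) (cantor_points I \<Sigma>) id"
proof -
  have "id \<in> hom (rearrangement_group I \<Sigma>) (BijGroup (cantor_points I \<Sigma>))"
    using rearrangements_bij by (fastforce simp: hom_def rearrangement_group_def BijGroup_def)
  then show ?thesis
    by (intro group_action.intro group_hom.intro group_hom_axioms.intro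
        group_rearrangement_group group_BijGroup)
qed

lemma rearrangement_group_mult:
  assumes "g \<in> rearrangements I \<Sigma>" "h \<in> rearrangements I \<Sigma>"
  shows "g \<otimes>\<^bsub>rearrangement_group I \<Sigma>\<^esub> h = compose (cantor_points I \<Sigma>) g h"
  using assms[THEN rearrangements_bij] by (simp add: rearrangement_group_def BijGroup_def)

text \<open>Let the letter \<open>a\<close> act as the pole shift whose attracting set is the subcube of the words
  \<open>w a\<close> and whose repelling set is the subcube of the inverse letter. Commuting generators use
  disjoint sets of coordinates, so that their pole shifts commute and preserve each other's subcubes.
  Ping-pong does the rest.\<close>

lemma commutation_group_embeds:
  fixes w :: "'s \<times> bool \<Rightarrow> 'i \<Rightarrow> 'a list"
  assumes I: "finite I" and fin: "\<forall>i\<in>I. finite (\<Sigma> i)"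
    and R: "\<And>l r. (l, r) \<in> R \<Longrightarrow> \<exists>s t. l = [(s, True), (t, True)] \<and> r = [(t, True), (s, True)]"
    and words: "\<And>s e. s \<in> S \<Longrightarrow> \<forall>i\<in>I. w (s, e) i \<in> lists (\<Sigma> i)"
    and supports: "\<And>s t d e. s \<in> S \<Longrightarrow> t \<in> S \<Longrightarrow> s \<noteq> t \<Longrightarrow> generators_commute S R s t \<Longrightarrow>
      \<forall>i\<in>I. w (s, d) i = [] \<or> w (t, e) i = []"
    and opposite: "\<And>s. s \<in> S \<Longrightarrow> subcube I \<Sigma> (w (s, True)) \<inter> subcube I \<Sigma> (w (s, False)) = {}"
    and separate: "\<And>s t d e. s \<in> S \<Longrightarrow> t \<in> S \<Longrightarrow> \<not> generators_commute S R s t \<Longrightarrow>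
      subcube I \<Sigma> (w (s, d)) \<inter> subcube I \<Sigma> (w (t, e)) = {}"
    and base: "x\<^sub>0 \<in> cantor_points I \<Sigma>" "\<And>s e. s \<in> S \<Longrightarrow> x\<^sub>0 \<notin> subcube I \<Sigma> (w (s, e))"
  shows "\<exists>f. f \<in> mon (presented_group S R) (rearrangement_group I \<Sigma>)"
proof -
  let ?U = "cantor_points I \<Sigma>" and ?G = "rearrangement_group I \<Sigma>"
  define H where "H s e = pole_shift ?U (prepend I (w (s, \<not> e))) (prepend I (w (s, e)))" for s e
  define \<rho> where "\<rho> s = H s True" for s
  interpret G: group ?G by (rule group_rearrangement_group)
  interpret act: group_action ?G ?U id by (rule group_action_rearrangement_group)
  have img: "prepend I (w (s, e)) ` ?U = subcube I \<Sigma> (w (s, e))" if "s \<in> S" for s e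
    using subcube_eq_prepend[OF words[OF that]] by simp
  have opp: "subcube I \<Sigma> (w (s, \<not> e)) \<inter> subcube I \<Sigma> (w (s, e)) = {}" if "s \<in> S" for s e
    using opposite[OF that] by (cases e) auto
  have emb: "disjoint_embeddings ?U (prepend I (w (s, \<not> e))) (prepend I (w (s, e)))" if "s \<in> S" for s e
    by (rule prepend_disjoint_embeddings[OF words[OF that] words[OF that] opp[OF that]])
  have H: "H s e \<in> rearrangements I \<Sigma>" if "s \<in> S" for s e
    unfolding H_def
    by (rule pole_shift_rearrangement[OF I fin words[OF that] words[OF that] opp[OF that]])
  have car: "carrier ?G = rearrangements I \<Sigma>" by (simp add: rearrangement_group_def)
  have \<rho>: "\<rho> \<in> S \<rightarrow> carrier ?G" using H by (simp add: \<rho>_def car)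
  have H_in: "H s e x \<in> ?U" if "s \<in> S" "x \<in> ?U" for s e x
    unfolding H_def by (rule disjoint_embeddings.shift_in[OF emb[OF that(1)] that(2)])
  have "inv\<^bsub>?G\<^esub> (H s True) = H s False" if s: "s \<in> S" for s
  proof (rule G.inv_equality)
    have "compose ?U (H s False) (H s True) = (\<lambda>x\<in>?U. x)"
    proof (rule ext)
      fix x
      show "compose ?U (H s False) (H s True) x = (\<lambda>x\<in>?U. x) x"
        using disjoint_embeddings.shift_inverse[OF emb[OF s, of True], of x]
        by (simp add: compose_def H_def)
    qed
    then show "H s False \<otimes>\<^bsub>?G\<^esub> H s True = \<one>\<^bsub>?G\<^esub>"
      using H[OF s] by (simp add: rearrangement_group_mult)
        (simp add: rearrangement_group_def BijGroup_def)
  qed (use H[OF s] in \<open>simp_all add: car\<close>)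
  then have letter: "letter_value ?G \<rho> (s, e) = H s e" if "s \<in> S" for s e
    using that by (cases e) (simp_all add: letter_value_def \<rho>_def)
  have H_prepend: "prepend I (w (s, d)) (H t e x) = H t e (prepend I (w (s, d)) x)"
    if st: "s \<in> S" "t \<in> S" "s \<noteq> t" "generators_commute S R s t" and x: "x \<in> ?U" for s t d e x
    unfolding H_def
  proof (rule disjoint_embeddings.shift_commute[OF emb[OF st(2)] _ _ _ _ _ x])
    fix y assume y: "y \<in> ?U"
    show "prepend I (w (s, d)) y \<in> ?U" by (rule prepend_in_subcube(2)[OF words[OF st(1)] y])
    note supp = supports[OF st(2,1) not_sym[OF st(3)] generators_commute_sym[OF st(4)]]
    show "prepend I (w (s, d)) (prepend I (w (t, \<not> e)) y) = prepend I (w (t, \<not> e)) (prepend I (w (s, d)) y)"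
      "prepend I (w (s, d)) (prepend I (w (t, e)) y) = prepend I (w (t, e)) (prepend I (w (s, d)) y)"
      using prepend_disjoint_support(1)[OF supp] by metis+
    show "y \<in> prepend I (w (t, \<not> e)) ` ?U" if "prepend I (w (s, d)) y \<in> prepend I (w (t, \<not> e)) ` ?U"
      using prepend_disjoint_support(2)[OF supp y] that unfolding img[OF st(2)] .
    show "y \<in> prepend I (w (t, e)) ` ?U" if "prepend I (w (s, d)) y \<in> prepend I (w (t, e)) ` ?U"
      using prepend_disjoint_support(2)[OF supp y] that unfolding img[OF st(2)] .
  qed
  have H_preserves: "H t e x \<in> subcube I \<Sigma> (w (s, d))"
    if st: "s \<in> S" "t \<in> S" "s \<noteq> t" "generators_commute S R s t" and x: "x \<in> subcube I \<Sigma> (w (s, d))"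
    for s t d e x
  proof -
    obtain y where "y \<in> ?U" "x = prepend I (w (s, d)) y" using x img[OF st(1)] by blast
    then have "H t e x = prepend I (w (s, d)) (H t e y)" using H_prepend[OF st] by simp
    then show ?thesis using prepend_in_subcube(1)[OF words[OF st(1)] H_in[OF st(2) \<open>y \<in> ?U\<close>]] by simp
  qed
  have H_commute: "H s d (H t e x) = H t e (H s d x)"
    if st: "s \<in> S" "t \<in> S" "s \<noteq> t" "generators_commute S R s t" and x: "x \<in> ?U" for s t d e x
    unfolding H_def[of t e]
  proof (rule disjoint_embeddings.shift_commute[OF emb[OF st(2)] _ _ _ _ _ x])
    fix y assume y: "y \<in> ?U"
    show "H s d y \<in> ?U" by (rule H_in[OF st(1) y])
    have ts: "t \<noteq> s" "generators_commute S R t s"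
      using st generators_commute_sym[of S R s t] by auto
    show "H s d (prepend I (w (t, \<not> e)) y) = prepend I (w (t, \<not> e)) (H s d y)"
      "H s d (prepend I (w (t, e)) y) = prepend I (w (t, e)) (H s d y)"
      using H_prepend[OF st(2,1) ts y] by metis+
    \<comment> \<open>Membership is reflected because the inverse shift \<open>H s (\<not> d)\<close> preserves the same subcubes.\<close>
    have undo: "H s (\<not> d) (H s d y) = y"
      using disjoint_embeddings.shift_inverse[OF emb[OF st(1)] y] by (simp add: H_def)
    have reflect: "y \<in> subcube I \<Sigma> (w (t, c))" if "H s d y \<in> subcube I \<Sigma> (w (t, c))" for c
      using H_preserves[OF st(2,1) ts that, of "\<not> d"] undo by simp
    show "y \<in> prepend I (w (t, \<not> e)) ` ?U" if "H s d y \<in> prepend I (w (t, \<not> e)) ` ?U"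
      using that reflect unfolding img[OF st(2)] by blast
    show "y \<in> prepend I (w (t, e)) ` ?U" if "H s d y \<in> prepend I (w (t, e)) ` ?U"
      using that reflect unfolding img[OF st(2)] by blast
  qed
  have commute: "\<rho> s \<otimes>\<^bsub>?G\<^esub> \<rho> t = \<rho> t \<otimes>\<^bsub>?G\<^esub> \<rho> s"
    if st: "s \<in> S" "t \<in> S" "generators_commute S R s t" for s t
  proof (cases "s = t")
    case False
    have "compose ?U (H s True) (H t True) = compose ?U (H t True) (H s True)"
      using H_commute[OF st(1,2) False st(3)] by (auto simp: compose_def)
    then show ?thesis using H st by (simp add: \<rho>_def rearrangement_group_mult)
  qed simp
  have rel: "\<forall>(l, r)\<in>R. l \<in> gwords S \<longrightarrow> r \<in> gwords S \<longrightarrow>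
      gword_value ?G \<rho> l = gword_value ?G \<rho> r"
  proof clarify
    fix l r assume lr: "(l, r) \<in> R" "l \<in> gwords S" "r \<in> gwords S"
    then obtain s t where st: "l = [(s, True), (t, True)]" "r = [(t, True), (s, True)]" using R by blast
    have "s \<in> S" "t \<in> S" using lr st by (auto simp: gwords_def)
    moreover have "generators_commute S R s t"
      using gword_eq.relation[of "[]" S "[]", OF _ _ lr] st
      by (simp add: generators_commute_def gwords_def)
    ultimately have "\<rho> s \<otimes>\<^bsub>?G\<^esub> \<rho> t = \<rho> t \<otimes>\<^bsub>?G\<^esub> \<rho> s" "\<rho> s \<in> carrier ?G" "\<rho> t \<in> carrier ?G"
      using commute \<rho> by auto
    then show "gword_value ?G \<rho> l = gword_value ?G \<rho> r" by (simp add: st letter_value_def)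
  qed
  show ?thesis
  proof (rule G.presented_group_mon[OF \<rho> rel])
    fix u assume u: "u \<in> gwords S" "gword_value ?G \<rho> u = \<one>\<^bsub>?G\<^esub>"
    show "gword_eq S R u []"
    proof (rule act.ping_pong[OF \<rho> rel _ _ _ _ base(1) _ u, where A = "\<lambda>a. subcube I \<Sigma> (w a)"])
      show "id (letter_value ?G \<rho> (s, e)) x \<in> subcube I \<Sigma> (w (s, e))"
        if "s \<in> S" "x \<in> ?U" "x \<notin> subcube I \<Sigma> (w (s, \<not> e))" for s e x
        using disjoint_embeddings.shift_outside[OF emb[OF that(1)] that(2)] that img
          prepend_in_subcube(1)[OF words[OF that(1)] that(2)] by (simp add: letter H_def)
      show "id (letter_value ?G \<rho> (t, e)) x \<in> subcube I \<Sigma> (w (s, d))"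
        if "s \<in> S" "t \<in> S" "s \<noteq> t" "generators_commute S R s t" "x \<in> ?U" "x \<in> subcube I \<Sigma> (w (s, d))"
        for s t d e x
        using H_preserves that by (simp add: letter)
    qed (use opposite separate base(2) in auto)
  qed
qed


section \<open>Coding generators and pairs of generators in a Cantor cube\<close>

lemma subcube_nth:
  assumes "x \<in> subcube I \<Sigma> \<alpha>" "i \<in> I" "m < length (\<alpha> i)"
  shows "x i m = \<alpha> i ! m"
proof -
  have "Omega_Words_Fun.prefix (length (\<alpha> i)) (x i) ! m = \<alpha> i ! m"
    using assms by (simp add: subcube_def)
  then show ?thesis using assms(3) by simp
qed

lemma subcubes_disjointI:
  assumes "i \<in> I" "m < length (\<alpha> i)" "m < length (\<beta> i)" "\<alpha> i ! m \<noteq> \<beta> i ! m"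
  shows "subcube I \<Sigma> \<alpha> \<inter> subcube I \<Sigma> \<beta> = {}"
  using assms subcube_nth[of _ I \<Sigma> _ i m] by fastforce

text \<open>The sign of a letter \<open>s\<^sup>\<plusminus>\<^sup>1\<close> is recorded in the coordinate of \<open>s\<close>, and \<open>s\<close> itself is recorded
  in the coordinates of all pairs containing it. So the subcubes of noncommuting generators are
  disjoint because of the coordinate of their pair, while commuting generators share no coordinate.
  The base point repeats in each coordinate a symbol \<open>z i\<close> such that no pair code is a string of these
  symbols; it avoids the subcubes of \<open>s\<close> because \<open>s\<close> lies in some pair.\<close>

lemma coded_commutation_group_embeds:
  fixes \<kappa> :: "'i \<Rightarrow> 's + 's set" and code :: "'s set \<Rightarrow> 's \<Rightarrow> 'a list"
  assumes S: "finite S"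
    and R: "\<And>l r. (l, r) \<in> R \<Longrightarrow> \<exists>s t. l = [(s, True), (t, True)] \<and> r = [(t, True), (s, True)]"
    and noncentral: "\<And>s. s \<in> S \<Longrightarrow> \<exists>t\<in>S. \<not> generators_commute S R s t"
    and P: "P = {{s, t} | s t. s \<in> S \<and> t \<in> S \<and> \<not> generators_commute S R s t}"
    and \<kappa>: "bij_betw \<kappa> I (S <+> P)"
    and fin: "\<forall>i\<in>I. finite (\<Sigma> i)"
    and mark: "mark True \<noteq> mark False" "\<And>i s b. i \<in> I \<Longrightarrow> \<kappa> i = Inl s \<Longrightarrow> mark b \<in> \<Sigma> i"
    and code: "\<And>i p s. i \<in> I \<Longrightarrow> \<kappa> i = Inr p \<Longrightarrow> s \<in> p \<Longrightarrow> code p s \<in> lists (\<Sigma> i) \<and> code p s \<noteq> []"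
      "\<And>p s t. p \<in> P \<Longrightarrow> s \<in> p \<Longrightarrow> t \<in> p \<Longrightarrow> s \<noteq> t \<Longrightarrow> code p s ! 0 \<noteq> code p t ! 0"
    and z: "\<And>i. i \<in> I \<Longrightarrow> z i \<in> \<Sigma> i"
      "\<And>i p s. i \<in> I \<Longrightarrow> \<kappa> i = Inr p \<Longrightarrow> s \<in> p \<Longrightarrow> \<exists>m<length (code p s). code p s ! m \<noteq> z i"
  shows "\<exists>f. f \<in> mon (presented_group S R) (rearrangement_group I \<Sigma>)"
proof -
  define w where "w a i = (case \<kappa> i of Inl t \<Rightarrow> if t = fst a then [mark (snd a)] else []
    | Inr p \<Rightarrow> if fst a \<in> p then code p (fst a) else [])" for a i
  have "P \<subseteq> Pow S" using P by blast
  then have "finite P" using S by (auto intro: finite_subset)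
  then have "finite (S <+> P)" using S by simp
  then have I: "finite I" using bij_betw_finite[OF \<kappa>] by simp
  have pair: "\<exists>i\<in>I. \<kappa> i = Inr {s, t} \<and> {s, t} \<in> P \<and> s \<noteq> t"
    if "s \<in> S" "t \<in> S" "\<not> generators_commute S R s t" for s t
  proof -
    have "{s, t} \<in> P" using P that by blast
    moreover then have "Inr {s, t} \<in> \<kappa> ` I" using bij_betw_imp_surj_on[OF \<kappa>] by auto
    moreover have "s \<noteq> t" using that generators_commute_refl by metis
    ultimately show ?thesis by fastforce
  qed
  show ?thesis
  proof (rule commutation_group_embeds[where w = w and x\<^sub>0 = "\<lambda>i\<in>I. \<lambda>_. z i", OF I fin R])
    show "\<forall>i\<in>I. w (s, b) i \<in> lists (\<Sigma> i)" if "s \<in> S" for s b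
      using mark(2) code(1) by (auto simp: w_def split: sum.split)
    show "\<forall>i\<in>I. w (s, d) i = [] \<or> w (t, e) i = []"
      if st: "s \<in> S" "t \<in> S" "s \<noteq> t" "generators_commute S R s t" for s t d e
    proof
      fix i assume i: "i \<in> I"
      show "w (s, d) i = [] \<or> w (t, e) i = []"
      proof (cases "\<kappa> i")
        case (Inl r)
        then show ?thesis using st(3) by (auto simp: w_def)
      next
        case (Inr p)
        have "p \<in> P" using bij_betw_apply[OF \<kappa> i] Inr by auto
        then obtain s' t' where "p = {s', t'}" "\<not> generators_commute S R s' t'" using P by blast
        then have "\<not> (s \<in> p \<and> t \<in> p)" using st(3,4) generators_commute_sym[of S R s t] by blast
        then show ?thesis using Inr by (auto simp: w_def)
      qed
    qed
    show "subcube I \<Sigma> (w (s, True)) \<inter> subcube I \<Sigma> (w (s, False)) = {}" if s: "s \<in> S" for s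
    proof -
      have "Inl s \<in> \<kappa> ` I" using bij_betw_imp_surj_on[OF \<kappa>] s by auto
      then obtain i where "i \<in> I" "\<kappa> i = Inl s" by force
      then show ?thesis using mark(1) by (intro subcubes_disjointI[of i _ 0]) (auto simp: w_def)
    qed
    show "subcube I \<Sigma> (w (s, d)) \<inter> subcube I \<Sigma> (w (t, e)) = {}"
      if st: "s \<in> S" "t \<in> S" "\<not> generators_commute S R s t" for s t d e
    proof -
      obtain i where i: "i \<in> I" "\<kappa> i = Inr {s, t}" "{s, t} \<in> P" "s \<noteq> t" using pair[OF st] by blast
      then have "code {s, t} s ! 0 \<noteq> code {s, t} t ! 0" "code {s, t} s \<noteq> []" "code {s, t} t \<noteq> []"
        using code(2)[OF i(3)] code(1)[OF i(1,2)] by auto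
      then show ?thesis using i by (intro subcubes_disjointI[of i _ 0]) (auto simp: w_def)
    qed
    show "(\<lambda>i\<in>I. \<lambda>_. z i) \<in> cantor_points I \<Sigma>" using z(1) by (auto simp: cantor_points_eq)
    show "(\<lambda>i\<in>I. \<lambda>_. z i) \<notin> subcube I \<Sigma> (w (s, e))" if s: "s \<in> S" for s e
    proof
      assume *: "(\<lambda>i\<in>I. \<lambda>_. z i) \<in> subcube I \<Sigma> (w (s, e))"
      obtain t where t: "t \<in> S" "\<not> generators_commute S R s t" using noncentral[OF s] by blast
      obtain i where i: "i \<in> I" "\<kappa> i = Inr {s, t}" using pair[OF s t] by blast
      then have "w (s, e) i = code {s, t} s" by (simp add: w_def)
      moreover obtain m where "m < length (code {s, t} s)" "code {s, t} s ! m \<noteq> z i"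
        using z(2)[OF i, of s] by auto
      ultimately show False using subcube_nth[OF * i(1), of m] i(1) by simp
    qed
  qed
qed


section \<open>Right-angled Artin groups\<close>

lemma presented_gens_commute_iff:
  assumes "s \<in> S" "t \<in> S"
  shows "presented_gen S R s \<otimes>\<^bsub>presented_group S R\<^esub> presented_gen S R t =
      presented_gen S R t \<otimes>\<^bsub>presented_group S R\<^esub> presented_gen S R s \<longleftrightarrow> generators_commute S R s t"
proof -
  have "[(s, True)] \<in> gwords S" "[(t, True)] \<in> gwords S" "[(s, True), (t, True)] \<in> gwords S"
    "[(t, True), (s, True)] \<in> gwords S"
    using assms by (auto simp: gwords_def)
  then show ?thesis
    by (simp add: presented_gen_def presented_group_mult generators_commute_def
        eq_equiv_class_iff[OF equiv_gword_rel]) (simp add: gword_rel_def)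
qed

text \<open>An element commuting with every generator commutes, letter by letter, with every word.\<close>

lemma noncentral_generator:
  assumes s: "s \<in> S" and nc: "presented_gen S R s \<notin> group_center (presented_group S R)"
  shows "\<exists>t\<in>S. \<not> generators_commute S R s t"
proof (rule ccontr)
  assume "\<not> ?thesis"
  then have comm: "generators_commute S R s t" if "t \<in> S" for t using that by blast
  let ?G = "presented_group S R"
  have sw: "[(s, True)] \<in> gwords S" using s by (simp add: gwords_def)
  have slide: "gword_eq S R ([(s, True)] @ u) (u @ [(s, True)])" if "u \<in> gwords S" for u
    using that
  proof (induction u)
    case Nil
    then show ?case using sw by (simp add: gword_eq.refl)
  next
    case (Cons a u)
    obtain t b where a: "a = (t, b)" by (cases a)
    have t: "t \<in> S" "u \<in> gwords S" "[a] \<in> gwords S" using Cons.prems a by (auto simp: gwords_def)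
    have "gword_eq S R ([(s, True), a] @ u) ([a, (s, True)] @ u)"
      unfolding a using generators_commute_letters[OF comm[OF t(1)]] gword_eq.refl[OF t(2)]
      by (rule gword_eq_append)
    moreover have "gword_eq S R ([a] @ [(s, True)] @ u) ([a] @ u @ [(s, True)])"
      using gword_eq.refl[OF t(3)] Cons.IH[OF t(2)] by (rule gword_eq_append)
    ultimately show ?case by (simp add: gword_eq.trans)
  qed
  have "presented_gen S R s \<otimes>\<^bsub>?G\<^esub> x = x \<otimes>\<^bsub>?G\<^esub> presented_gen S R s" if "x \<in> carrier ?G" for x
  proof -
    obtain u where u: "u \<in> gwords S" "x = gword_rel S R `` {u}"
      using \<open>x \<in> carrier ?G\<close> by (auto simp: presented_group_def elim: quotientE)
    have "gword_rel S R `` {[(s, True)] @ u} = gword_rel S R `` {u @ [(s, True)]}"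
      by (rule equiv_class_eq[OF equiv_gword_rel])
        (simp only: gword_rel_def mem_Collect_eq case_prod_conv slide[OF u(1)])
    then show ?thesis using u sw by (simp add: presented_gen_def presented_group_mult)
  qed
  moreover have "presented_gen S R s \<in> carrier ?G"
    using sw by (simp add: presented_gen_def presented_group_def quotientI)
  ultimately show False using nc by (simp add: group_center_def)
qed

theorem theorem4p1:
  fixes n :: nat and v :: "nat \<Rightarrow> 'v" and V :: "'v set" and E :: "'v set set"
    and P :: "nat set set"
  assumes "simple_graph V E"
    and "bij_betw v {1..n} V"
    and "\<forall>i\<in>{1..n}. raag_gen n v E i \<notin> group_center (raag n v E)"
    and "P = noncommuting_pairs n v E"
  shows "(\<exists>f. f \<in> mon (raag n v E) (rearrangement_group ({1..n} <+> P) raag_alphabet)) \<and>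
         (\<exists>f. f \<in> mon (raag n v E) (brin_thompson (n + card P)))"
proof -
  let ?S = "{1..n}" and ?R = "raag_relations n v E"
  have R: "\<exists>s t. l = [(s, True), (t, True)] \<and> r = [(t, True), (s, True)]" if "(l, r) \<in> ?R" for l r
    using that by (auto simp: raag_relations_def)
  have noncentral: "\<exists>t\<in>?S. \<not> generators_commute ?S ?R s t" if "s \<in> ?S" for s
    using noncentral_generator[OF that, of ?R] assms(3) that
    unfolding raag_gen_def raag_def by blast
  have P: "P = {{s, t} | s t. s \<in> ?S \<and> t \<in> ?S \<and> \<not> generators_commute ?S ?R s t}"
    unfolding assms(4) noncommuting_pairs_def raag_def raag_gen_def
    using presented_gens_commute_iff[of _ ?S _ ?R] by blast
  have pairs: "finite p" "p \<noteq> {}" if "p \<in> P" for p using that P by auto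
  have finP: "finite P" by (rule finite_subset[of _ "Pow ?S"]) (use P in auto)
  have "\<exists>f. f \<in> mon (presented_group ?S ?R) (rearrangement_group (?S <+> P) raag_alphabet)"
  proof (rule coded_commutation_group_embeds[OF finite_atLeastAtMost R noncentral P,
        where \<kappa> = id and mark = "\<lambda>b. Bit (if b then 1 else 0)" and code = "\<lambda>p s. [Idx s]"
          and z = "\<lambda>i. case i of Inl _ \<Rightarrow> Bit 0 | Inr _ \<Rightarrow> Blank"])
  qed (use pairs in auto)
  moreover have "\<exists>f. f \<in> mon (presented_group ?S ?R) (rearrangement_group {1..n + card P} (\<lambda>_. {0, 1::nat}))"
  proof -
    have "finite (?S <+> P)" "card {1..n + card P} = card (?S <+> P)"
      using finP by (simp_all add: card_Plus)
    then obtain \<kappa> where \<kappa>: "bij_betw \<kappa> {1..n + card P} (?S <+> P)"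
      using finite_same_card_bij[of "{1..n + card P}" "?S <+> P"] by blast
    \<comment> \<open>The two elements of a pair and \<open>\<emptyset>\<close> are coded by \<open>0\<close>, \<open>10\<close> and \<open>11\<close>.\<close>
    let ?code = "\<lambda>p s. if s = Min p then [0] else [1, 0::nat]"
    have "?code p s ! 0 \<noteq> ?code p t ! 0" if p: "p \<in> P" "s \<in> p" "t \<in> p" "s \<noteq> t" for p s t
    proof -
      have "p = {s, t}" using p P by blast
      then have "Min p = s \<or> Min p = t" using Min_in[OF pairs[OF p(1)]] by blast
      then show ?thesis using p(4) by auto
    qed
    then show ?thesis
      by (intro coded_commutation_group_embeds[OF finite_atLeastAtMost R noncentral P \<kappa>,
            where mark = "\<lambda>b. if b then 1 else 0" and code = ?code and z = "\<lambda>_. 1"])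
        (auto simp: less_Suc_eq)
  qed
  ultimately show ?thesis by (simp add: raag_def brin_thompson_def)
qed

end
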